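(* A graph is $2$-winding if and only if it contains $K_4$ or $K_{2,3}$ as a minor.
   Context: Graphs are finite and are identified with their geometric realizations (1-dimensional complexes). For a closed curve $g$ in $\mathbb{R}^2$, let $W_{\neq0}(g)$ be the union of the image of $g$ with the set of points $x$ not on the image around which $g$ has nonzero winding number. A graph $G$ is called $q$-winding if for every continuous map $f:G\to\mathbb{R}^2$ there are $q$ pairwise vertex-disjoint subgraphs $P_1,\dots,P_q$ of $G$, each a path (possibly a single vertex) or a cycle, such that $\big(\bigcap_{P_i\text{ a path}} f(P_i)\big)\cap\big(\bigcap_{P_i\text{ a cycle}} W_{\neq0}(f|_{P_i})\big)\neq\emptyset$. *)

theory Defs
  imports "HOL-Complex_Analysis.Complex_Analysis"
begin

section \<open>Finite simple graphs\<close>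

record 'a sgraph =
  verts :: "'a set"
  edges :: "'a set set"

definition simple_graph :: "'a sgraph \<Rightarrow> bool" where
  "simple_graph G \<longleftrightarrow> finite (verts G) \<and> (\<forall>e\<in>edges G. e \<subseteq> verts G \<and> card e = 2)"

definition subgraph_of :: "'a sgraph \<Rightarrow> 'a sgraph \<Rightarrow> bool" where
  "subgraph_of P G \<longleftrightarrow> simple_graph P \<and> verts P \<subseteq> verts G \<and> edges P \<subseteq> edges G"

definition path_graph :: "'a sgraph \<Rightarrow> bool" where
  "path_graph P \<longleftrightarrow> (\<exists>vs. vs \<noteq> [] \<and> distinct vs \<and> verts P = set vs \<and>
     edges P = {{vs ! i, vs ! Suc i} |i. Suc i < length vs})"

definition cycle_graph :: "'a sgraph \<Rightarrow> bool" where
  "cycle_graph P \<longleftrightarrow> (\<exists>vs. 3 \<le> length vs \<and> distinct vs \<and> verts P = set vs \<and>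
     edges P = {{vs ! i, vs ! (Suc i mod length vs)} |i. i < length vs})"

definition complete_graph :: "nat \<Rightarrow> nat sgraph" where
  "complete_graph n = \<lparr>verts = {..<n}, edges = {e. e \<subseteq> {..<n} \<and> card e = 2}\<rparr>"

definition complete_bipartite_graph :: "nat \<Rightarrow> nat \<Rightarrow> (nat + nat) sgraph" where
  "complete_bipartite_graph m n =
     \<lparr>verts = {..<m} <+> {..<n}, edges = {{Inl i, Inr j} |i j. i < m \<and> j < n}\<rparr>"


section \<open>Minors\<close>

definition connected_in :: "'a sgraph \<Rightarrow> 'a set \<Rightarrow> bool" where
  "connected_in G B \<longleftrightarrow> B \<noteq> {} \<and>
     (\<forall>x\<in>B. \<forall>y\<in>B. (x, y) \<in> {(u, v). u \<in> B \<and> v \<in> B \<and> {u, v} \<in> edges G}\<^sup>*)"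

text \<open>
  \<^term>\<open>B v\<close> is the branch set of the vertex \<^term>\<open>v\<close> of \<^term>\<open>H\<close>: contracting all branch
  sets and deleting superfluous vertices and edges of \<^term>\<open>G\<close> yields \<^term>\<open>H\<close>.
\<close>

definition has_minor :: "'a sgraph \<Rightarrow> 'b sgraph \<Rightarrow> bool" where
  "has_minor G H \<longleftrightarrow> (\<exists>B :: 'b \<Rightarrow> 'a set.
     (\<forall>v\<in>verts H. B v \<subseteq> verts G \<and> connected_in G (B v)) \<and>
     (\<forall>v\<in>verts H. \<forall>w\<in>verts H. v \<noteq> w \<longrightarrow> B v \<inter> B w = {}) \<and>
     (\<forall>v w. {v, w} \<in> edges H \<longrightarrow> (\<exists>x\<in>B v. \<exists>y\<in>B w. {x, y} \<in> edges G)))"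


section \<open>Geometric realization and winding\<close>

text \<open>
  Points are given by their barycentric coordinates: those of a point are supported on a
  single vertex or on the two ends of an edge. The topology is the one induced by the product
  topology on functions, which for finitely many vertices is the usual one. The realization
  of a subgraph is literally a subset of the realization of the graph.
\<close>

definition realization :: "'a sgraph \<Rightarrow> ('a \<Rightarrow> real) set" where
  "realization G = {x. (\<forall>v. 0 \<le> x v) \<and> (\<Sum>v\<in>verts G. x v) = 1 \<and>
     {v. x v \<noteq> 0} \<in> (\<lambda>v. {v}) ` verts G \<union> edges G}"

text \<open>The plane is identified with \<^typ>\<open>complex\<close>; \<^term>\<open>g\<close> is meant to be a closed curve
  parametrized over the unit interval.\<close>

definition W_nonzero :: "(real \<Rightarrow> complex) \<Rightarrow> complex set" where
  "W_nonzero g = path_image g \<union> {x. x \<notin> path_image g \<and> winding_number g x \<noteq> 0}"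

definition loop_around :: "(real \<Rightarrow> 'a \<Rightarrow> real) \<Rightarrow> 'a sgraph \<Rightarrow> bool" where
  "loop_around \<gamma> C \<longleftrightarrow> simple_path \<gamma> \<and> pathfinish \<gamma> = pathstart \<gamma> \<and> path_image \<gamma> = realization C"

text \<open>
  The restriction of \<^term>\<open>f\<close> to a cycle is viewed as a closed curve by traversing the cycle
  once. Different traversals change winding numbers only by a sign, so all of them give the
  same set and the union below is over equal sets.
\<close>

definition W_nonzero_cycle :: "(('a \<Rightarrow> real) \<Rightarrow> complex) \<Rightarrow> 'a sgraph \<Rightarrow> complex set" where
  "W_nonzero_cycle f C = (\<Union>\<gamma>\<in>{\<gamma>. loop_around \<gamma> C}. W_nonzero (f \<circ> \<gamma>))"

definition winding_graph :: "nat \<Rightarrow> 'a sgraph \<Rightarrow> bool" where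
  "winding_graph q G \<longleftrightarrow>
     (\<forall>f :: ('a \<Rightarrow> real) \<Rightarrow> complex. continuous_on (realization G) f \<longrightarrow>
       (\<exists>P :: nat \<Rightarrow> 'a sgraph.
          (\<forall>i<q. subgraph_of (P i) G \<and> (path_graph (P i) \<or> cycle_graph (P i))) \<and>
          (\<forall>i<q. \<forall>j<q. i \<noteq> j \<longrightarrow> verts (P i) \<inter> verts (P j) = {}) \<and>
          (\<Inter>i\<in>{i. i < q \<and> path_graph (P i)}. f ` realization (P i)) \<inter>
          (\<Inter>i\<in>{i. i < q \<and> cycle_graph (P i)}. W_nonzero_cycle f (P i)) \<noteq> {}))"

end

theory Submission
  imports Defs
begin

text \<open>
  A minor-free graph is outerplanar: gluing along separations of order at most one reduces to the
  case where a longest cycle must be Hamiltonian (otherwise a component off the cycle gives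
  \<open>K\<^sub>2\<^sub>,\<^sub>3\<close>) and its chords do not cross (otherwise \<open>K\<^sub>4\<close>). Placing
  the vertices in this order on a parabola and extending affinely, disjoint connected subgraphs get
  disjoint convex hulls, and winding numbers vanish outside the hull.

  Conversely, both graphs are subcubic, so a minor yields a subdivision. If all vertex-disjoint paths
  have disjoint images, let \<open>W v u w\<close> be the winding number around the vertex \<open>v\<close> of
  the image of the path from \<open>u\<close> to \<open>w\<close>. A continuous logarithm of
  \<open>p s - q t\<close> for disjoint paths \<open>p\<close>, \<open>q\<close> gives one linear relation per
  pair of disjoint edges. Modulo these, the suitably signed sum of the winding numbers of the cycles
  around the vertices disjoint from them is \<open>2 * S\<close> with \<open>exp (2 * pi * \<i> * S) = - 1\<close>,
  so they cannot all vanish.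
\<close>

section \<open>Winding numbers of disjoint paths\<close>

text \<open>The winding number of an open path is a complex number: its real part is the swept angle
  in turns, its imaginary part records the change of distance. So
  \<open>exp (2 * of_real pi * \<i> * W v u w)\<close> is exactly the ratio of
  \<open>P w - P v\<close> to \<open>P u - P v\<close>, and all relations are exact linear equations
  with complex coefficients, in which 2 may be cancelled. This takes the place of counting crossings
  of a map in general position, so an arbitrary continuous \<open>f\<close> can be treated directly.
  The value -1 comes from reversing three differences. For K4, \<open>S\<close> is the angle sum of
  the triangle on three image points. For K_{2,3}, it compares the two cyclic orders of the three
  vertices of degree 2, with angles measured from one vertex of degree 3. In the other direction the
  parabola serves as a strictly convex curve: a single line cuts off exactly its points over an
  interval, so intervals of the order turn into half-planes.\<close>

lemma winding_number_log:
  assumes "continuous_on {0..1} L" "\<And>t. t \<in> {0..1} \<Longrightarrow> p t - z = exp (L t)"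
  shows "winding_number p z = (L 1 - L 0) / (2 * of_real pi * \<i>)"
proof -
  have "winding_number p z = winding_number (\<lambda>t. p t - z) 0"
    by (rule winding_number_offset)
  also have "\<dots> = winding_number (exp \<circ> L) 0"
  proof (rule winding_number_homotopic_paths, rule homotopic_paths_eq)
    show "path (\<lambda>t. p t - z)"
      unfolding path_def using assms
      by (metis (no_types, lifting) continuous_on_cong continuous_on_exp)
  qed (use assms in \<open>auto simp: path_image_def\<close>)
  also have "\<dots> = (L 1 - L 0) / (2 * of_real pi * \<i>)"
    using winding_number_compose_exp[of L] assms(1) by (simp add: path_def pathfinish_def pathstart_def)
  finally show ?thesis .
qed

text \<open>The unit square is contractible and \<open>p s - q t\<close> never vanishes on it, so
  the difference has a continuous logarithm there. Up to the factor
  \<open>2 * of_real pi * \<i>\<close>, both sides are the increment of this logarithm from corner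
  (0, 0) to corner (1, 1), taken along the two routes on the boundary.\<close>

lemma winding_number_square:
  fixes p q :: "real \<Rightarrow> complex"
  assumes "path p" "path q" "path_image p \<inter> path_image q = {}"
  shows "winding_number p (pathstart q) + winding_number q (pathfinish p)
       = winding_number q (pathstart p) + winding_number p (pathfinish q)"
proof -
  define S where "S = cbox (0::real, 0::real) (1, 1)"
  have S: "(s, t) \<in> S \<longleftrightarrow> s \<in> {0..1} \<and> t \<in> {0..1}" for s t
    by (auto simp: S_def cbox_Pair_eq)
  have cp: "continuous_on S (\<lambda>x. p (fst x))" "continuous_on S (\<lambda>x. q (snd x))"
    using assms unfolding path_def
    by (auto intro!: continuous_on_compose2[of "{0..1}" p] continuous_on_compose2[of "{0..1}" q]
        continuous_intros simp: S)
  have ne: "p s - q t \<noteq> 0" if "s \<in> {0..1}" "t \<in> {0..1}" for s t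
    using assms(3) that by (force simp: path_image_def)
  have "contractible S"
    unfolding S_def by (intro convex_imp_contractible convex_box)
  moreover have "continuous_on S (\<lambda>x. p (fst x) - q (snd x))"
    using cp by (intro continuous_intros)
  ultimately obtain g where g: "continuous_on S g" "\<And>x. x \<in> S \<Longrightarrow> p (fst x) - q (snd x) = exp (g x)"
    using continuous_logarithm_on_contractible[of S "\<lambda>x. p (fst x) - q (snd x)"] ne S
    by (smt (verit, ccfv_threshold) prod.collapse)
  have c1: "continuous_on {0..1} (\<lambda>s. g (s, t))" if "t \<in> {0..1}" for t
    using that S by (intro continuous_on_compose2[OF g(1)] continuous_intros) auto
  \<comment> \<open>Seen from \<open>p s\<close>, the difference has the opposite sign. The added
    half period accounts for it and cancels in increments.\<close>
  have c2: "continuous_on {0..1} (\<lambda>t. g (s, t) + \<i> * of_real pi)" if "s \<in> {0..1}" for s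
    using that S by (intro continuous_on_compose2[OF g(1)] continuous_intros) auto
  have e1: "p s - q t = exp (g (s, t))" if "s \<in> {0..1}" "t \<in> {0..1}" for s t
    using g(2)[of "(s, t)"] S that by simp
  have e2: "q t - p s = exp (g (s, t) + \<i> * of_real pi)" if "s \<in> {0..1}" "t \<in> {0..1}" for s t
    using e1[OF that] by (simp add: exp_add algebra_simps)
  have "winding_number p (q t) = (g (1, t) - g (0, t)) / (2 * of_real pi * \<i>)" if "t \<in> {0..1}" for t
    using winding_number_log[OF c1[OF that] e1[OF _ that]] by simp
  moreover have "winding_number q (p s) = (g (s, 1) - g (s, 0)) / (2 * of_real pi * \<i>)"
    if "s \<in> {0..1}" for s
    using winding_number_log[OF c2[OF that] e2[OF that]] by simp
  ultimately show ?thesis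
    by (simp add: pathstart_def pathfinish_def add_divide_distrib[symmetric] diff_divide_distrib)
qed

section \<open>Parity contradictions for K4 and K_{2,3}\<close>

text \<open>Read \<open>W v u w\<close> as the angle at \<open>v\<close> from \<open>u\<close> to
  \<open>w\<close>. The linear relations force the angle sum
  \<open>W a b d + W d a b + W b d a\<close> of a triangle to be 0, whereas the three corresponding
  ratios of differences multiply to -1.\<close>

lemma K4_winding_parity:
  fixes W :: "'h \<Rightarrow> 'h \<Rightarrow> 'h \<Rightarrow> complex" and P :: "'h \<Rightarrow> complex"
  assumes dist: "distinct [a,b,c,d]" and inj: "inj_on P {a,b,c,d}"
    and exp: "\<And>v u w. distinct [v,u,w] \<Longrightarrow> set [v,u,w] \<subseteq> {a,b,c,d} \<Longrightarrow>
      P w - P v = exp (2 * of_real pi * \<i> * W v u w) * (P u - P v)"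
    and anti: "\<And>v u w. distinct [v,u,w] \<Longrightarrow> set [v,u,w] \<subseteq> {a,b,c,d} \<Longrightarrow> W v w u = - W v u w"
    and square: "\<And>u w u' w'. distinct [u,w,u',w'] \<Longrightarrow> set [u,w,u',w'] \<subseteq> {a,b,c,d} \<Longrightarrow>
      W u' u w + W w u' w' = W u u' w' + W w' u w"
    and cyc: "\<And>v u w x. distinct [v,u,w,x] \<Longrightarrow> set [v,u,w,x] \<subseteq> {a,b,c,d} \<Longrightarrow>
      W v u w + W v w x + W v x u = 0"
  shows False
proof -
  have cycles: "W d a b + W d b c + W d c a = 0" "W c a b + W c b d + W c d a = 0"
     "W b a c + W b c d + W b d a = 0" "W a b c + W a c d + W a d b = 0"
    using dist by (auto intro!: cyc)
  have squares: "W c a b + W b c d = W a c d + W d a b" "W a b c + W c a d = W b a d + W d b c"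
    "W b c a + W a b d = W c b d + W d c a"
    using dist by (auto intro!: square)
  have antis: "W c d a = - W c a d" "W b a c = - W b c a" "W b d a = - W b a d" "W a d b = - W a b d"
    using dist by (auto intro!: anti)
  \<comment> \<open>Adding the squares, one for each pair of opposite edges, and substituting the
    cycles gives a relation with an overall factor 2. After cancelling it, one more square and one
    more cycle lead here.\<close>
  have eq: "W a b d + W d a b = W b a d"
    using cycles squares unfolding antis by algebra
  define X where "X = exp (2 * of_real pi * \<i> * W a b d)"
  define Y where "Y = exp (2 * of_real pi * \<i> * W d a b)"
  have "exp (2 * of_real pi * \<i> * W b a d) = X * Y"
    by (simp add: X_def Y_def eq[symmetric] ring_distribs exp_add)
  hence "P d - P b = X * Y * (P a - P b)"
    using exp[of b a d] dist by auto
  moreover have "P d - P a = X * (P b - P a)" "P b - P d = Y * (P a - P d)"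
    using exp[of a b d] exp[of d a b] dist by (auto simp: X_def Y_def)
  moreover have "P a \<noteq> P d" "P b \<noteq> P d"
    using inj dist by (auto simp: inj_on_def)
  \<comment> \<open>The last two ratios turn \<open>X * Y * (P a - P b)\<close> into
    \<open>P b - P d\<close>, so \<open>P d - P b\<close> is its own negative.\<close>
  ultimately show False by algebra
qed

text \<open>The ratios \<open>(P w - P v) / (P a - P v)\<close> are multiplied over both cyclic
  orders of \<open>x\<close>, \<open>y\<close>, \<open>z\<close>. The denominators agree and the
  numerators differ by three reversed differences, that is, by the sign -1. The linear relations
  nevertheless make the two products equal.\<close>

lemma K23_winding_parity:
  fixes W :: "'h \<Rightarrow> 'h \<Rightarrow> 'h \<Rightarrow> complex" and P :: "'h \<Rightarrow> complex"
  assumes dist: "distinct [a,b,x,y,z]" and inj: "inj_on P {a,b,x,y,z}"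
    and exp: "\<And>v u w. u \<in> {a,b} \<Longrightarrow> v \<in> {x,y,z} \<Longrightarrow> w \<in> {x,y,z} \<Longrightarrow> v \<noteq> w \<Longrightarrow>
      P w - P v = exp (2 * of_real pi * \<i> * W v u w) * (P u - P v)"
    and anti: "\<And>v u w. u \<in> {a,b} \<Longrightarrow> v \<in> {x,y,z} \<Longrightarrow> w \<in> {x,y,z} \<Longrightarrow> v \<noteq> w \<Longrightarrow> W v w u = - W v u w"
    and square: "\<And>w w'. w \<in> {x,y,z} \<Longrightarrow> w' \<in> {x,y,z} \<Longrightarrow> w \<noteq> w' \<Longrightarrow>
      W w' a w + W w w' b = W a w' b + W b a w"
    and cyc: "\<And>v w w'. distinct [v,w,w'] \<Longrightarrow> set [v,w,w'] \<subseteq> {x,y,z} \<Longrightarrow>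
      W v a w + W v w b + W v b w' + W v w' a = 0"
  shows False
proof -
  have cycles: "W x a y + W x y b + W x b z + W x z a = 0" "W y a z + W y z b + W y b x + W y x a = 0"
     "W z a x + W z x b + W z b y + W z y a = 0"
    using dist by (auto intro!: cyc)
  have squares: "W y a x + W x y b = W a y b + W b a x" "W z a x + W x z b = W a z b + W b a x"
    "W z a y + W y z b = W a z b + W b a y" "W x a y + W y x b = W a x b + W b a y"
    "W x a z + W z x b = W a x b + W b a z" "W y a z + W z y b = W a y b + W b a z"
    using dist by (auto intro!: square)
  have antis: "W x z b = - W x b z" "W x z a = - W x a z" "W y x b = - W y b x" "W y x a = - W y a x"
    "W z y b = - W z b y" "W z y a = - W z a y"
    using dist by (auto intro!: anti)
  \<comment> \<open>There are six pairs of disjoint edges. Eliminating the terms around paths from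
    \<open>b\<close> with their squares and adding the three cycles shows that the difference of the
    two sides equals its own negative.\<close>
  have eq: "W z a x + W x a y + W y a z = W y a x + W z a y + W x a z"
    using cycles squares unfolding antis by algebra
  define E where "E = (\<lambda>v w. exp (2 * of_real pi * \<i> * W v a w))"
  have "E z x * E x y * E y z = exp (2 * of_real pi * \<i> * (W z a x + W x a y + W y a z))"
    by (simp add: E_def ring_distribs exp_add)
  also have "\<dots> = E y x * E z y * E x z"
    unfolding eq by (simp add: E_def ring_distribs exp_add)
  finally have "E z x * E x y * E y z = E y x * E z y * E x z" .
  moreover have "P w - P v = E v w * (P a - P v)" if "v \<in> {x,y,z}" "w \<in> {x,y,z}" "v \<noteq> w" for v w
    using exp[of a v w] that by (auto simp: E_def)
  hence "P x - P z = E z x * (P a - P z)" "P x - P y = E y x * (P a - P y)"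
    "P y - P x = E x y * (P a - P x)" "P y - P z = E z y * (P a - P z)"
    "P z - P y = E y z * (P a - P y)" "P z - P x = E x z * (P a - P x)"
    using dist by auto
  moreover have "P x \<noteq> P y" "P x \<noteq> P z" "P y \<noteq> P z"
    using inj dist by (auto simp: inj_on_def)
  ultimately show False by algebra
qed

section \<open>Connected sets and topological minors\<close>

definition path_between :: "'a sgraph \<Rightarrow> 'a \<Rightarrow> 'a list \<Rightarrow> 'a \<Rightarrow> bool" where
  "path_between G u ws v \<longleftrightarrow> ws \<noteq> [] \<and> hd ws = u \<and> last ws = v \<and> distinct ws \<and>
     successively (\<lambda>x y. {x, y} \<in> edges G) ws"

definition touching :: "'a sgraph \<Rightarrow> 'a set \<Rightarrow> 'a set \<Rightarrow> bool" where
  "touching G A B \<longleftrightarrow> (\<exists>x\<in>A. \<exists>y\<in>B. {x, y} \<in> edges G)"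

definition induced :: "'a sgraph \<Rightarrow> 'a set \<Rightarrow> 'a sgraph" where
  "induced G A = \<lparr>verts = A, edges = {e \<in> edges G. e \<subseteq> A}\<rparr>"

lemma simple_graph_induced: "simple_graph G \<Longrightarrow> A \<subseteq> verts G \<Longrightarrow> simple_graph (induced G A)"
  by (auto simp: simple_graph_def induced_def finite_subset)

lemma edge_neq: "simple_graph G \<Longrightarrow> {u, v} \<in> edges G \<Longrightarrow> u \<noteq> v"
  by (auto simp: simple_graph_def)

lemma edge_verts: "simple_graph G \<Longrightarrow> {u, v} \<in> edges G \<Longrightarrow> u \<in> verts G \<and> v \<in> verts G"
  by (auto simp: simple_graph_def)

lemma touching_sym: "touching G A B \<longleftrightarrow> touching G B A"
  unfolding touching_def by (metis insert_commute)

lemma successively_sym: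
  "successively (\<lambda>x y. {y, x} \<in> E) ws = successively (\<lambda>x y. {x, y} \<in> E) ws"
  by (simp add: insert_commute)

lemma path_between_rev: "path_between G u ws v \<Longrightarrow> path_between G v (rev ws) u"
  by (auto simp: path_between_def hd_rev last_rev successively_sym)

lemma path_between_prefix: "path_between G u (xs @ c # ys) v \<Longrightarrow> path_between G u (xs @ [c]) c"
  by (auto simp: path_between_def successively_append_iff hd_append split: if_splits)

lemma path_between_suffix: "path_between G u (xs @ c # ys) v \<Longrightarrow> path_between G c (c # ys) v"
  by (auto simp: path_between_def successively_append_iff)

lemma path_between_append:
  "path_between G u xs v \<Longrightarrow> path_between G x ys y \<Longrightarrow> {v, x} \<in> edges G \<Longrightarrow> set xs \<inter> set ys = {} \<Longrightarrow>
   path_between G u (xs @ ys) y"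
  by (auto simp: path_between_def successively_append_iff)

lemma path_between_glue:
  assumes "path_between G u xs v" "path_between G v ys w" "set xs \<inter> set ys \<subseteq> {v}"
  shows "path_between G u (xs @ tl ys) w"
proof (cases ys)
  case (Cons y zs)
  then show ?thesis
    using assms by (cases zs) (auto simp: path_between_def successively_append_iff)
qed (use assms in \<open>auto simp: path_between_def\<close>)

lemma path_between_ends: "path_between G u ws v \<Longrightarrow> u \<in> set ws \<and> v \<in> set ws"
  by (auto simp: path_between_def)

section \<open>Connected vertex sets\<close>

definition conn_rel :: "'a sgraph \<Rightarrow> 'a set \<Rightarrow> ('a \<times> 'a) set" where
  "conn_rel G B = {(u, v). u \<in> B \<and> v \<in> B \<and> {u, v} \<in> edges G}"

lemma connected_in_alt: "connected_in G B \<longleftrightarrow> B \<noteq> {} \<and> (\<forall>x\<in>B. \<forall>y\<in>B. (x, y) \<in> (conn_rel G B)\<^sup>*)"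
  by (simp add: connected_in_def conn_rel_def)

lemma sym_conn_rel: "sym ((conn_rel G B)\<^sup>*)"
  by (rule sym_rtrancl) (auto simp: sym_def conn_rel_def insert_commute)

lemma conn_rel_mono: "A \<subseteq> B \<Longrightarrow> (conn_rel G A)\<^sup>* \<subseteq> (conn_rel G B)\<^sup>*"
  by (intro rtrancl_mono) (auto simp: conn_rel_def)

lemma connected_in_rootI:
  assumes "r \<in> B" "\<And>x. x \<in> B \<Longrightarrow> (r, x) \<in> (conn_rel G B)\<^sup>*"
  shows "connected_in G B"
  using assms sym_conn_rel[of G B] unfolding connected_in_alt
  by (metis empty_iff rtrancl_trans symD)

lemma connected_in_singleton: "connected_in G {x}"
  by (rule connected_in_rootI) auto

lemma connected_in_Un:
  assumes "connected_in G A" "connected_in G B" "touching G A B"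
  shows "connected_in G (A \<union> B)"
proof -
  obtain x y where xy: "x \<in> A" "y \<in> B" "{x, y} \<in> edges G"
    using assms(3) by (auto simp: touching_def)
  have *: "(x, a) \<in> (conn_rel G (A \<union> B))\<^sup>*" if "a \<in> A" for a
    using that xy assms(1) conn_rel_mono[of A "A \<union> B" G] by (auto simp: connected_in_alt)
  have "(y, b) \<in> (conn_rel G (A \<union> B))\<^sup>*" if "b \<in> B" for b
    using that xy assms(2) conn_rel_mono[of B "A \<union> B" G] by (auto simp: connected_in_alt)
  moreover have "(x, y) \<in> conn_rel G (A \<union> B)"
    using xy by (auto simp: conn_rel_def)
  ultimately show ?thesis
    using * xy(1) by (intro connected_in_rootI[of x]) (auto intro: converse_rtrancl_into_rtrancl)
qed

lemma connected_in_set: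
  assumes "ws \<noteq> []" "successively (\<lambda>x y. {x, y} \<in> edges G) ws"
  shows "connected_in G (set ws)"
  using assms
proof (induction ws rule: induct_list012)
  case (3 x y zs)
  have "connected_in G ({x} \<union> set (y # zs))"
    using 3 by (intro connected_in_Un connected_in_singleton) (auto simp: touching_def)
  then show ?case by (simp add: insert_commute)
qed (auto simp: connected_in_singleton)

lemma connected_in_path_between:
  assumes "connected_in G B" "x \<in> B" "y \<in> B"
  obtains ws where "path_between G x ws y" "set ws \<subseteq> B"
proof -
  have "(x, y) \<in> (conn_rel G B)\<^sup>*"
    using assms by (auto simp: connected_in_alt)
  hence "\<exists>ws. path_between G x ws y \<and> set ws \<subseteq> B"
  proof induction
    case base
    show ?case using assms by (intro exI[of _ "[x]"]) (auto simp: path_between_def)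
  next
    case (step y z)
    then obtain ws where ws: "path_between G x ws y" "set ws \<subseteq> B" by blast
    show ?case
    proof (cases "z \<in> set ws")
      case True
      then obtain us vs where "ws = us @ z # vs" by (auto simp: in_set_conv_decomp)
      with ws show ?thesis
        by (intro exI[of _ "us @ [z]"]) (auto dest: path_between_prefix)
    next
      case False
      have "path_between G z [z] z" by (simp add: path_between_def)
      with ws step(2) False show ?thesis
        by (intro exI[of _ "ws @ [z]"]) (auto simp: conn_rel_def intro: path_between_append)
    qed
  qed
  with that show thesis by blast
qed

text \<open>A discrete intermediate value theorem: a walk from \<open>x\<close> to \<open>y\<close>
  inside \<open>B\<close> leaves \<open>P\<close> along some edge.\<close>

lemma connected_in_crossing_edge:
  assumes "connected_in G B" "x \<in> B" "y \<in> B" "P x" "\<not> P y"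
  obtains u v where "u \<in> B" "v \<in> B" "{u, v} \<in> edges G" "P u" "\<not> P v"
proof -
  have "(x, y) \<in> (conn_rel G B)\<^sup>*"
    using assms by (auto simp: connected_in_alt)
  hence "P y \<or> (\<exists>u v. u \<in> B \<and> v \<in> B \<and> {u, v} \<in> edges G \<and> P u \<and> \<not> P v)"
    using assms(4)
    by induction (auto simp: conn_rel_def)
  with assms(5) that show thesis by blast
qed

section \<open>Tripods in connected sets\<close>

text \<open>Follow \<open>Q\<close> from \<open>u3\<close> to its first vertex on \<open>P\<close>,
  which exists because both paths contain \<open>u1\<close>. That vertex is the centre and splits
  \<open>P\<close> into the other two legs. A leg may consist of the centre alone.\<close>

lemma connected_tripod:
  assumes B: "connected_in G B" and u: "u1 \<in> B" "u2 \<in> B" "u3 \<in> B"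
  obtains c l1 l2 l3 where
    "path_between G c l1 u1" "path_between G c l2 u2" "path_between G c l3 u3"
    "set l1 \<union> set l2 \<union> set l3 \<subseteq> B"
    "set l1 \<inter> set l2 = {c}" "set l1 \<inter> set l3 = {c}" "set l2 \<inter> set l3 = {c}"
proof -
  obtain P where P: "path_between G u1 P u2" "set P \<subseteq> B"
    using connected_in_path_between[OF B u(1,2)] .
  obtain Q where Q: "path_between G u3 Q u1" "set Q \<subseteq> B"
    using connected_in_path_between[OF B u(3,1)] .
  have "\<exists>c\<in>set Q. c \<in> set P"
    using P Q path_between_ends by metis
  then obtain q1 c q2 where Qs: "Q = q1 @ c # q2" "c \<in> set P" "\<forall>y\<in>set q1. y \<notin> set P"
    using split_list_first_prop[of Q "\<lambda>c. c \<in> set P"] by blast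
  then obtain p1 p2 where Ps: "P = p1 @ c # p2"
    by (auto simp: in_set_conv_decomp)
  have "distinct P" using P by (simp add: path_between_def)
  show thesis
  proof (rule that[of c "rev (p1 @ [c])" "c # p2" "rev (q1 @ [c])"])
    show "path_between G c (rev (p1 @ [c])) u1" "path_between G c (c # p2) u2" "path_between G c (rev (q1 @ [c])) u3"
      using P(1) Q(1) unfolding Ps Qs(1) by (auto intro: path_between_rev path_between_prefix path_between_suffix simp del: rev_append)
  qed (use P(2) Q(2) Qs \<open>distinct P\<close> Ps in auto)
qed

lemma card_le_3_subset:
  assumes "finite N" "card N \<le> 3"
  obtains n1 n2 n3 where "N \<subseteq> {n1, n2, n3}"
proof -
  obtain xs where xs: "set xs = N" "length xs = card N"
    using assms(1) by (metis finite_distinct_list distinct_card)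
  obtain n1 n2 n3 where "set xs \<subseteq> {n1, n2, n3}"
  proof (cases xs)
    case (Cons a ys)
    show ?thesis
    proof (cases ys)
      case Nil
      with Cons that show thesis by auto
    next
      case (Cons b zs)
      show thesis
      proof (cases zs)
        case Nil
        with Cons \<open>xs = a # ys\<close> that[of a b b] show thesis by auto
      next
        case (Cons d ws)
        with \<open>xs = a # ys\<close> \<open>ys = b # zs\<close> xs(2) assms(2) have "ws = []" by (cases ws) auto
        with Cons \<open>xs = a # ys\<close> \<open>ys = b # zs\<close> that[of a b d] show thesis by auto
      qed
    qed
  qed auto
  with xs that show thesis by auto
qed

text \<open>This is where maximum degree 3 enters: three ends in a connected set always have a
  common centre with disjoint legs, but four need not, as a tree shaped like the letter H
  shows.\<close>

lemma connected_legs: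
  assumes B: "connected_in G B" and N: "finite N" "card N \<le> 3"
    and att: "\<And>w. w \<in> N \<Longrightarrow> att w \<in> B"
  obtains c l where "c \<in> B" "\<And>w. w \<in> N \<Longrightarrow> path_between G c (l w) (att w)"
    "\<And>w. w \<in> N \<Longrightarrow> set (l w) \<subseteq> B"
    "\<And>w w'. w \<in> N \<Longrightarrow> w' \<in> N \<Longrightarrow> w \<noteq> w' \<Longrightarrow> set (l w) \<inter> set (l w') = {c}"
proof -
  obtain b where b: "b \<in> B" using B by (auto simp: connected_in_def)
  obtain n1 n2 n3 where n: "N \<subseteq> {n1, n2, n3}"
    using card_le_3_subset[OF N] .
  \<comment> \<open>Names outside \<open>N\<close> only pad the list to three, and they are attached
    at the arbitrary vertex \<open>b\<close>.\<close>
  define at' where "at' w = (if w \<in> N then att w else b)" for w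
  have at': "at' w \<in> B" for w using b att by (simp add: at'_def)
  obtain c l1 l2 l3 where l: "path_between G c l1 (at' n1)" "path_between G c l2 (at' n2)" "path_between G c l3 (at' n3)"
    "set l1 \<union> set l2 \<union> set l3 \<subseteq> B"
    "set l1 \<inter> set l2 = {c}" "set l1 \<inter> set l3 = {c}" "set l2 \<inter> set l3 = {c}"
    using connected_tripod[OF B at' at' at'] .
  \<comment> \<open>The names \<open>n1\<close>, \<open>n2\<close>, \<open>n3\<close> may coincide;
    the first match decides.\<close>
  define l where "l w = (if w = n1 then l1 else if w = n2 then l2 else l3)" for w
  have 1: "c \<in> B" using l by auto
  have 2: "path_between G c (l w) (att w)" if "w \<in> N" for w
    using that n l by (auto simp: l_def at'_def split: if_splits)
  have 3: "set (l w) \<subseteq> B" for w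
    using l by (auto simp: l_def)
  have 4: "set (l w) \<inter> set (l w') = {c}" if "w \<in> N" "w' \<in> N" "w \<noteq> w'" for w w'
  proof -
    from that n consider "w = n1" "w' \<noteq> n1" | "w' = n1" "w \<noteq> n1"
      | "w \<noteq> n1" "w' \<noteq> n1" "w = n2" "w' \<noteq> n2" | "w \<noteq> n1" "w' \<noteq> n1" "w' = n2" "w \<noteq> n2"
      by blast
    thus ?thesis
      using l(5-7) by cases (simp_all add: l_def Int_commute)
  qed
  show thesis by (rule that[OF 1 2 3 4])
qed

section \<open>From subcubic minors to subdivisions\<close>

text \<open>A subdivision of \<open>H\<close> inside \<open>G\<close>. Both orientations of a
  subdivided edge are recorded because winding numbers along them have opposite signs.\<close>

definition topological_minor ::
    "'a sgraph \<Rightarrow> 'b sgraph \<Rightarrow> ('b \<Rightarrow> 'a) \<Rightarrow> ('b \<Rightarrow> 'b \<Rightarrow> 'a list) \<Rightarrow> bool" where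
  "topological_minor G H c p \<longleftrightarrow>
     inj_on c (verts H) \<and> c ` verts H \<subseteq> verts G \<and>
     (\<forall>v w. {v, w} \<in> edges H \<longrightarrow> path_between G (c v) (p v w) (c w) \<and> p w v = rev (p v w) \<and>
        (\<forall>u\<in>verts H. c u \<in> set (p v w) \<longrightarrow> u \<in> {v, w})) \<and>
     (\<forall>v w u. {v, w} \<in> edges H \<longrightarrow> {v, u} \<in> edges H \<longrightarrow> w \<noteq> u \<longrightarrow> set (p v w) \<inter> set (p v u) = {c v}) \<and>
     (\<forall>v w t u. {v, w} \<in> edges H \<longrightarrow> {t, u} \<in> edges H \<longrightarrow> {v, w} \<inter> {t, u} = {} \<longrightarrow>
        set (p v w) \<inter> set (p t u) = {})"

text \<open>In each branch set the vertex is realized by the centre of a tripod whose legs reach the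
  edges leaving the set. A subdivided edge consists of a leg, a connecting edge and a reversed
  leg.\<close>

lemma subcubic_minor_imp_topological_minor:
  assumes G: "simple_graph G" and H: "simple_graph H" and minor: "has_minor G H"
    and deg: "\<And>v. v \<in> verts H \<Longrightarrow> card {w. {v, w} \<in> edges H} \<le> 3"
  obtains c p where "topological_minor G H c p"
proof -
  obtain B where "(\<forall>v\<in>verts H. B v \<subseteq> verts G \<and> connected_in G (B v)) \<and>
     (\<forall>v\<in>verts H. \<forall>w\<in>verts H. v \<noteq> w \<longrightarrow> B v \<inter> B w = {}) \<and>
     (\<forall>v w. {v, w} \<in> edges H \<longrightarrow> (\<exists>x\<in>B v. \<exists>y\<in>B w. {x, y} \<in> edges G))"
    using minor unfolding has_minor_def by (elim exE)
  hence B: "\<And>v. v \<in> verts H \<Longrightarrow> B v \<subseteq> verts G" "\<And>v. v \<in> verts H \<Longrightarrow> connected_in G (B v)"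
    and disj: "\<And>v w. v \<in> verts H \<Longrightarrow> w \<in> verts H \<Longrightarrow> v \<noteq> w \<Longrightarrow> B v \<inter> B w = {}"
    and adj: "\<And>v w. {v, w} \<in> edges H \<Longrightarrow> \<exists>x\<in>B v. \<exists>y\<in>B w. {x, y} \<in> edges G"
    by simp_all
  \<comment> \<open>The edge of \<open>G\<close> is chosen per unordered pair, so that
    \<open>att v w\<close> and \<open>att w v\<close> will be the two ends of the same edge.\<close>
  have "\<forall>e\<in>edges H. \<exists>g\<in>edges G. \<forall>v w. e = {v, w} \<longrightarrow> (\<exists>x\<in>B v. \<exists>y\<in>B w. g = {x, y})"
  proof
    fix e assume e: "e \<in> edges H"
    then obtain v w where vw: "e = {v, w}" using H by (auto simp: simple_graph_def card_2_iff)
    then obtain x y where xy: "x \<in> B v" "y \<in> B w" "{x, y} \<in> edges G" using adj e by blast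
    thus "\<exists>g\<in>edges G. \<forall>v w. e = {v, w} \<longrightarrow> (\<exists>x\<in>B v. \<exists>y\<in>B w. g = {x, y})"
      unfolding vw by (intro bexI[of _ "{x, y}"]) (auto simp: doubleton_eq_iff)
  qed
  then obtain g where g: "\<And>v w. {v, w} \<in> edges H \<Longrightarrow> g {v, w} \<in> edges G \<and> (\<exists>x\<in>B v. \<exists>y\<in>B w. g {v, w} = {x, y})"
    by metis
  define att where "att v w = (SOME x. x \<in> g {v, w} \<inter> B v)" for v w
  have att: "att v w \<in> B v" "{att v w, att w v} \<in> edges G" if vw: "{v, w} \<in> edges H" for v w
  proof -
    obtain x y where xy: "x \<in> B v" "y \<in> B w" "g {v, w} = {x, y}" using g[OF vw] by blast
    have "v \<noteq> w" "v \<in> verts H" "w \<in> verts H"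
      using edge_neq[OF H vw] edge_verts[OF H vw] by auto
    hence "B v \<inter> B w = {}" using disj by blast
    hence "g {v, w} \<inter> B v = {x}" "g {v, w} \<inter> B w = {y}" using xy by auto
    hence "att v w = x" "att w v = y"
      by (simp_all add: att_def insert_commute)
    thus "att v w \<in> B v" "{att v w, att w v} \<in> edges G" using xy g[OF vw] by auto
  qed
  have "\<forall>v\<in>verts H. \<exists>c l. c \<in> B v \<and> (\<forall>w. {v, w} \<in> edges H \<longrightarrow> path_between G c (l w) (att v w) \<and> set (l w) \<subseteq> B v) \<and>
      (\<forall>w w'. {v, w} \<in> edges H \<longrightarrow> {v, w'} \<in> edges H \<longrightarrow> w \<noteq> w' \<longrightarrow> set (l w) \<inter> set (l w') = {c})"
  proof
    fix v assume v: "v \<in> verts H"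
    have "{w. {v, w} \<in> edges H} \<subseteq> verts H" using edge_verts[OF H] by auto
    hence fin: "finite {w. {v, w} \<in> edges H}"
      using H by (auto simp: simple_graph_def finite_subset)
    obtain c l where "c \<in> B v" "\<And>w. w \<in> {w. {v, w} \<in> edges H} \<Longrightarrow> path_between G c (l w) (att v w)"
      "\<And>w. w \<in> {w. {v, w} \<in> edges H} \<Longrightarrow> set (l w) \<subseteq> B v"
      "\<And>w w'. w \<in> {w. {v, w} \<in> edges H} \<Longrightarrow> w' \<in> {w. {v, w} \<in> edges H} \<Longrightarrow> w \<noteq> w' \<Longrightarrow> set (l w) \<inter> set (l w') = {c}"
      by (rule connected_legs[OF B(2)[OF v] fin deg[OF v], of "att v"]) (use att in auto)
    thus "\<exists>c l. c \<in> B v \<and> (\<forall>w. {v, w} \<in> edges H \<longrightarrow> path_between G c (l w) (att v w) \<and> set (l w) \<subseteq> B v) \<and>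
      (\<forall>w w'. {v, w} \<in> edges H \<longrightarrow> {v, w'} \<in> edges H \<longrightarrow> w \<noteq> w' \<longrightarrow> set (l w) \<inter> set (l w') = {c})"
      by (intro exI[of _ c] exI[of _ l]) auto
  qed
  then obtain c l where c: "\<And>v. v \<in> verts H \<Longrightarrow> c v \<in> B v"
    and l0: "\<And>v w. v \<in> verts H \<Longrightarrow> {v, w} \<in> edges H \<Longrightarrow> path_between G (c v) (l v w) (att v w) \<and> set (l v w) \<subseteq> B v"
    and l1: "\<And>v w w'. v \<in> verts H \<Longrightarrow> {v, w} \<in> edges H \<Longrightarrow> {v, w'} \<in> edges H \<Longrightarrow> w \<noteq> w' \<Longrightarrow> set (l v w) \<inter> set (l v w') = {c v}"
    by metis
  define p where "p v w = l v w @ rev (l w v)" for v w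
  have Hv: "v \<in> verts H" "w \<in> verts H" "v \<noteq> w" "{w, v} \<in> edges H" if "{v, w} \<in> edges H" for v w
    using edge_verts[OF H that] edge_neq[OF H that] that by (auto simp: insert_commute)
  have l: "path_between G (c v) (l v w) (att v w)" "set (l v w) \<subseteq> B v"
      "path_between G (c w) (l w v) (att w v)" "set (l w v) \<subseteq> B w" if "{v, w} \<in> edges H" for v w
    using l0 Hv[OF that] that by blast+
  have sp: "set (p v w) = set (l v w) \<union> set (l w v)" for v w
    by (simp add: p_def)
  show thesis
  proof (rule that[of c p], unfold topological_minor_def, intro conjI allI impI ballI)
    show "inj_on c (verts H)"
      using disj c by (intro inj_onI) (metis disjoint_iff)
    show "c ` verts H \<subseteq> verts G" using c B by blast
  next
    fix v w assume vw: "{v, w} \<in> edges H"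
    show "path_between G (c v) (p v w) (c w)"
      unfolding p_def using l[OF vw] att(2)[OF vw] disj[OF Hv(1-3)[OF vw]]
      by (intro path_between_append path_between_rev) auto
    show "p w v = rev (p v w)" by (simp add: p_def)
    fix u assume "u \<in> verts H" "c u \<in> set (p v w)"
    thus "u \<in> {v, w}"
      using l(2,4)[OF vw] sp c Hv[OF vw] disj
      by (metis Un_iff disjoint_iff insert_iff subsetD)
  next
    fix v w u assume vw: "{v, w} \<in> edges H" and vu: "{v, u} \<in> edges H" and "w \<noteq> u"
    have "B w \<inter> B u = {}" "B v \<inter> B u = {}" "B w \<inter> B v = {}"
      using disj Hv[OF vw] Hv[OF vu] \<open>w \<noteq> u\<close> by blast+
    hence "set (l w v) \<inter> set (l u v) = {}" "set (l v w) \<inter> set (l u v) = {}" "set (l w v) \<inter> set (l v u) = {}"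
      using l(2,4)[OF vw] l(2,4)[OF vu] by blast+
    thus "set (p v w) \<inter> set (p v u) = {c v}"
      using l1[OF Hv(1)[OF vw] vw vu \<open>w \<noteq> u\<close>] unfolding sp by (simp add: Int_Un_distrib Int_Un_distrib2)
  next
    fix v w t u assume vw: "{v, w} \<in> edges H" and tu: "{t, u} \<in> edges H" and "{v, w} \<inter> {t, u} = {}"
    hence "B v \<inter> B t = {}" "B v \<inter> B u = {}" "B w \<inter> B t = {}" "B w \<inter> B u = {}"
      using disj Hv[OF vw] Hv[OF tu] by auto
    moreover have "set (p v w) \<subseteq> B v \<union> B w" "set (p t u) \<subseteq> B t \<union> B u"
      using l(2,4)[OF vw] l(2,4)[OF tu] unfolding sp by blast+
    ultimately show "set (p v w) \<inter> set (p t u) = {}"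
      by blast
  qed
qed

section \<open>Outerplanarity\<close>

text \<open>Crossing is invariant under cyclic shifts of the order, so only one interleaving pattern is
  excluded.\<close>

definition noncrossing :: "('a \<Rightarrow> real) \<Rightarrow> 'a sgraph \<Rightarrow> bool" where
  "noncrossing r G \<longleftrightarrow> inj_on r (verts G) \<and>
     (\<forall>a b c d. {a, c} \<in> edges G \<longrightarrow> {b, d} \<in> edges G \<longrightarrow> \<not> (r a < r b \<and> r b < r c \<and> r c < r d))"

text \<open>Length 2 is allowed, so that a single edge counts as a closed walk and a longest one exists as
  soon as there is an edge.\<close>

definition closed_walk :: "'a sgraph \<Rightarrow> 'a list \<Rightarrow> bool" where
  "closed_walk G vs \<longleftrightarrow> distinct vs \<and> 2 \<le> length vs \<and>
     successively (\<lambda>x y. {x, y} \<in> edges G) vs \<and> {last vs, hd vs} \<in> edges G"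

section \<open>Branch sets for K4 and K_{2,3}\<close>

lemma has_minor_mono:
  assumes "has_minor G' H" "verts G' \<subseteq> verts G" "edges G' \<subseteq> edges G"
  shows "has_minor G H"
proof -
  obtain B where B: "(\<forall>v\<in>verts H. B v \<subseteq> verts G' \<and> connected_in G' (B v)) \<and>
     (\<forall>v\<in>verts H. \<forall>w\<in>verts H. v \<noteq> w \<longrightarrow> B v \<inter> B w = {}) \<and>
     (\<forall>v w. {v, w} \<in> edges H \<longrightarrow> (\<exists>x\<in>B v. \<exists>y\<in>B w. {x, y} \<in> edges G'))"
    using assms(1) unfolding has_minor_def by (elim exE)
  have conn: "connected_in G S" if "connected_in G' S" for S
  proof -
    have "(conn_rel G' S)\<^sup>* \<subseteq> (conn_rel G S)\<^sup>*"
      using assms(3) by (intro rtrancl_mono) (auto simp: conn_rel_def)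
    with that show ?thesis by (auto simp: connected_in_alt)
  qed
  show ?thesis
    unfolding has_minor_def
  proof (intro exI[of _ B] conjI ballI allI impI)
    fix v w assume "{v, w} \<in> edges H"
    hence "\<exists>x\<in>B v. \<exists>y\<in>B w. {x, y} \<in> edges G'" using B by simp
    thus "\<exists>x\<in>B v. \<exists>y\<in>B w. {x, y} \<in> edges G" using assms(3) by blast
  qed (use B conn assms(2) in auto)
qed

lemma has_minor_induced: "has_minor (induced G S) H \<Longrightarrow> S \<subseteq> verts G \<Longrightarrow> has_minor G H"
  by (rule has_minor_mono[of "induced G S"]) (auto simp: induced_def)

lemma K4_minorI:
  assumes "A \<union> B \<union> C \<union> D \<subseteq> verts G"
    "connected_in G A" "connected_in G B" "connected_in G C" "connected_in G D"
    "A \<inter> B = {}" "A \<inter> C = {}" "A \<inter> D = {}" "B \<inter> C = {}" "B \<inter> D = {}" "C \<inter> D = {}"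
    "touching G A B" "touching G A C" "touching G A D" "touching G B C" "touching G B D" "touching G C D"
  shows "has_minor G (complete_graph 4)"
proof -
  define S where "S n = (if n = 0 then A else if n = 1 then B else if n = 2 then C else D)" for n :: nat
  have lt4: "n = 0 \<or> n = 1 \<or> n = 2 \<or> n = 3" if "n < 4" for n :: nat
    using that by auto
  have S: "S 0 = A" "S 1 = B" "S (Suc 0) = B" "S 2 = C" "S 3 = D"
    by (auto simp: S_def)
  have 1: "S v \<subseteq> verts G \<and> connected_in G (S v)" if "v < 4" for v
    using lt4[OF that] assms(1-5) by (elim disjE) (simp_all add: S)
  have 2: "S v \<inter> S w = {} \<and> touching G (S v) (S w)" if "v < 4" "w < 4" "v \<noteq> w" for v w
    using lt4[OF that(1)] lt4[OF that(2)] that(3) assms(6-) touching_sym[of G]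
    by (elim disjE) (simp_all add: S Int_commute)
  have 3: "v < 4 \<and> w < 4 \<and> v \<noteq> w" if "{v, w} \<in> edges (complete_graph 4)" for v w
    using that by (auto simp: complete_graph_def card_2_iff doubleton_eq_iff)
  show ?thesis
    unfolding has_minor_def touching_def[symmetric]
  proof (intro exI[of _ S] conjI ballI allI impI)
    show "touching G (S v) (S w)" if "{v, w} \<in> edges (complete_graph 4)" for v w
      using 2 3[OF that] by blast
  qed (use 1 2 in \<open>simp_all add: complete_graph_def\<close>)
qed

lemma K23_minorI:
  assumes "X \<union> Y \<union> A \<union> B \<union> C \<subseteq> verts G"
    "connected_in G X" "connected_in G Y" "connected_in G A" "connected_in G B" "connected_in G C"
    "X \<inter> Y = {}" "X \<inter> A = {}" "X \<inter> B = {}" "X \<inter> C = {}" "Y \<inter> A = {}" "Y \<inter> B = {}" "Y \<inter> C = {}"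
    "A \<inter> B = {}" "A \<inter> C = {}" "B \<inter> C = {}"
    "touching G X A" "touching G X B" "touching G X C" "touching G Y A" "touching G Y B" "touching G Y C"
  shows "has_minor G (complete_bipartite_graph 2 3)"
proof -
  let ?K = "complete_bipartite_graph 2 3"
  define S where "S = case_sum (\<lambda>n::nat. if n = 0 then X else Y)
     (\<lambda>n::nat. if n = 0 then A else if n = 1 then B else C)"
  have vK: "v = Inl 0 \<or> v = Inl 1 \<or> v = Inr 0 \<or> v = Inr 1 \<or> v = Inr 2" if "v \<in> verts ?K" for v
    using that by (force simp: complete_bipartite_graph_def)
  have S: "S (Inl 0) = X" "S (Inl 1) = Y" "S (Inl (Suc 0)) = Y"
    "S (Inr 0) = A" "S (Inr 1) = B" "S (Inr (Suc 0)) = B" "S (Inr 2) = C"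
    by (auto simp: S_def)
  have 1: "S v \<subseteq> verts G \<and> connected_in G (S v)" if "v \<in> verts ?K" for v
    using vK[OF that] assms(1-6) by (elim disjE) (simp_all add: S)
  have 2: "S v \<inter> S w = {}" if "v \<in> verts ?K" "w \<in> verts ?K" "v \<noteq> w" for v w
    using vK[OF that(1)] vK[OF that(2)] that(3) assms(7-16)
    by (elim disjE) (simp_all add: S Int_commute)
  have 3: "touching G (S v) (S w)" if e: "{v, w} \<in> edges ?K" for v w
  proof -
    obtain i j :: nat where ij: "{v, w} = {Inl i, Inr j}" "i < 2" "j < 3"
      using e unfolding complete_bipartite_graph_def by auto
    have "i = 0 \<or> i = 1" "j = 0 \<or> j = 1 \<or> j = 2" using ij by auto
    hence "touching G (S (Inl i)) (S (Inr j))"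
      using assms(17-) by (elim disjE) (simp_all add: S)
    thus ?thesis
      using ij(1) touching_sym[of G] by (auto simp: doubleton_eq_iff)
  qed
  show ?thesis
    unfolding has_minor_def touching_def[symmetric]
    by (intro exI[of _ S] conjI ballI allI impI) (use 1 2 3 in simp_all)
qed

section \<open>Rotating and gluing noncrossing orders\<close>

lemma noncrossingD:
  "noncrossing r G \<Longrightarrow> {a, c} \<in> edges G \<Longrightarrow> {b, d} \<in> edges G \<Longrightarrow> \<not> (r a < r b \<and> r b < r c \<and> r c < r d)"
  by (simp add: noncrossing_def)

text \<open>The order is rotated cyclically until \<open>v\<close> comes last, the position at which
  another piece can be appended.\<close>

lemma noncrossing_normalize:
  assumes G: "simple_graph G" and r: "noncrossing r G"
  obtains r' where "noncrossing r' G" "r' v = 0" "\<And>w. w \<in> verts G \<Longrightarrow> w \<noteq> v \<Longrightarrow> r' w < 0"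
proof -
  have "bounded (r ` verts G)"
    using G by (intro finite_imp_bounded) (auto simp: simple_graph_def)
  then obtain K where K: "\<And>w. w \<in> verts G \<Longrightarrow> \<bar>r w\<bar> \<le> K"
    by (auto simp: bounded_iff)
  have E: "a \<in> verts G \<and> c \<in> verts G" if "{a, c} \<in> edges G" for a c
    using edge_verts[OF G that] .
  show thesis
  proof (cases "v \<in> verts G")
    case True
    \<comment> \<open>All values lie within \<open>K\<close> of 0, so they differ by at most
      \<open>2 * K\<close>. Subtracting \<open>2 * K + 1\<close> moves whatever lies above
      \<open>v\<close> below everything else.\<close>
    define r' where "r' w = (if r w > r v then r w - r v - 2 * K - 1 else r w - r v)" for w
    have "inj_on r' (verts G)"
    proof (rule inj_onI)
      fix x y assume "x \<in> verts G" "y \<in> verts G" "r' x = r' y"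
      hence "r x = r y"
        using K[of x] K[of y] by (auto simp: r'_def split: if_splits)
      thus "x = y"
        using r \<open>x \<in> verts G\<close> \<open>y \<in> verts G\<close> by (auto simp: noncrossing_def inj_on_def)
    qed
    moreover have "\<not> (r' a < r' b \<and> r' b < r' c \<and> r' c < r' d)"
      if e: "{a, c} \<in> edges G" "{b, d} \<in> edges G" for a b c d
    proof
      assume lt: "r' a < r' b \<and> r' b < r' c \<and> r' c < r' d"
      note nc = noncrossingD[OF r]
      \<comment> \<open>The wrap-around may fall between any two successive vertices of the
        quadruple or nowhere, so all four rotations of the pattern are needed.\<close>
      have N: "\<not> (r a < r b \<and> r b < r c \<and> r c < r d)" "\<not> (r b < r c \<and> r c < r d \<and> r d < r a)"
        "\<not> (r c < r d \<and> r d < r a \<and> r a < r b)" "\<not> (r d < r a \<and> r a < r b \<and> r b < r c)"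
        using nc[OF e] nc[of b d c a] nc[of c a d b] nc[of d b a c] e by (simp_all add: insert_commute)
      \<comment> \<open>An ascent of \<open>r'\<close> is an ascent of \<open>r\<close> within one
        block or the jump from the shifted block to the other, which can happen only once in a
        chain.\<close>
      have step: "(r x > r v \<longleftrightarrow> r y > r v) \<and> r x < r y \<or> r x > r v \<and> r y \<le> r v"
        if "r' x < r' y" "x \<in> verts G" "y \<in> verts G" for x y
        using that K[of x] K[of y] by (auto simp: r'_def split: if_splits)
      show False
        using step[of a b] step[of b c] step[of c d] lt N E[OF e(1)] E[OF e(2)]
        by (smt (verit))
    qed
    ultimately have "noncrossing r' G" by (auto simp: noncrossing_def)
    moreover have "r' w < 0" if "w \<in> verts G" "w \<noteq> v" for w
    proof -
      have "r w \<noteq> r v" using r that True by (auto simp: noncrossing_def inj_on_def)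
      thus ?thesis using K[OF that(1)] K[OF True] by (auto simp: r'_def)
    qed
    ultimately show thesis using that[of r'] by (simp add: r'_def)
  next
    case False
    define r' where "r' w = (if w = v then 0 else r w - K - 1)" for w
    have "inj_on r' (verts G)"
      using r False by (auto simp: noncrossing_def inj_on_def r'_def)
    moreover have "\<not> (r' a < r' b \<and> r' b < r' c \<and> r' c < r' d)"
      if e: "{a, c} \<in> edges G" "{b, d} \<in> edges G" for a b c d
      using r e E[OF e(1)] E[OF e(2)] False by (auto simp: noncrossing_def r'_def)
    ultimately have "noncrossing r' G" by (auto simp: noncrossing_def)
    moreover have "r' w < 0" if "w \<in> verts G" "w \<noteq> v" for w
      using K[OF that(1)] that(2) by (auto simp: r'_def)
    ultimately show thesis using that[of r'] by (simp add: r'_def)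
  qed
qed

lemma noncrossing_uminus: "noncrossing r G \<Longrightarrow> noncrossing (\<lambda>w. - r w) G"
  by (auto simp: noncrossing_def inj_on_def insert_commute)

text \<open>With \<open>v\<close> last in the order of \<open>A\<close> and, after a reflection,
  first in the order of \<open>B\<close>, the two orders are concatenated at 0. Vertices of
  \<open>A\<close> are then nonpositive and vertices of \<open>B\<close> nonnegative, so an edge of
  \<open>A\<close> cannot interleave with an edge of \<open>B\<close>.\<close>

lemma noncrossing_glue:
  assumes G: "simple_graph G" and AB: "A \<union> B = verts G" "A \<inter> B \<subseteq> {v}"
    and sep: "\<And>x y. x \<in> A - B \<Longrightarrow> y \<in> B - A \<Longrightarrow> {x, y} \<notin> edges G"
    and rA: "noncrossing rA (induced G A)" and rB: "noncrossing rB (induced G B)"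
  obtains r where "noncrossing r G"
proof -
  obtain r1 where r1: "noncrossing r1 (induced G A)" "r1 v = 0" "\<And>w. w \<in> A \<Longrightarrow> w \<noteq> v \<Longrightarrow> r1 w < 0"
    using noncrossing_normalize[OF simple_graph_induced[OF G] rA, of v] AB
    by (auto simp: induced_def)
  obtain r2' where r2': "noncrossing r2' (induced G B)" "r2' v = 0" "\<And>w. w \<in> B \<Longrightarrow> w \<noteq> v \<Longrightarrow> r2' w < 0"
    using noncrossing_normalize[OF simple_graph_induced[OF G] rB, of v] AB
    by (auto simp: induced_def)
  define r2 where "r2 w = - r2' w" for w
  have r2: "noncrossing r2 (induced G B)" "r2 v = 0" "\<And>w. w \<in> B \<Longrightarrow> w \<noteq> v \<Longrightarrow> r2 w > 0"
    using r2' noncrossing_uminus[OF r2'(1)] by (auto simp: r2_def[abs_def])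
  define r where "r w = (if w \<in> A then r1 w else r2 w)" for w
  have rAle: "r w = r1 w" "r w \<le> 0" if "w \<in> A" for w
    using that r1(2) r1(3)[of w] by (cases "w = v"; force simp: r_def)+
  have rBge: "r w = r2 w" "r w \<ge> 0" if "w \<in> B" for w
    using that AB(2) r1(2) r2(2) r2(3)[of w] by (cases "w = v"; force simp: r_def)+
  have inj: "inj_on r1 A" "inj_on r2 B"
    using r1(1) r2(1) by (simp_all add: noncrossing_def induced_def)
  have zero: "w = v" if "w \<in> verts G" "r w = 0" for w
    using that AB(1) rAle(1)[of w] rBge(1)[of w] r1(3)[of w] r2(3)[of w] by fastforce
  have "inj_on r (verts G)"
  proof (rule inj_onI)
    fix x y assume xy: "x \<in> verts G" "y \<in> verts G" "r x = r y"
    show "x = y"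
    proof (cases "(x \<in> A \<and> y \<in> A) \<or> (x \<in> B \<and> y \<in> B)")
      case True
      thus ?thesis
        using xy(3) inj rAle(1)[of x] rAle(1)[of y] rBge(1)[of x] rBge(1)[of y]
        by (auto dest: inj_onD)
    next
      case False
      hence "(x \<in> A \<and> y \<in> B) \<or> (x \<in> B \<and> y \<in> A)" using xy AB(1) by auto
      hence "r x = 0 \<and> r y = 0"
        using rAle(2)[of x] rAle(2)[of y] rBge(2)[of x] rBge(2)[of y] xy(3) by linarith
      thus ?thesis using zero[of x] zero[of y] xy(1,2) by simp
    qed
  qed
  moreover have False if e: "{a, c} \<in> edges G" "{b, d} \<in> edges G" "r a < r b" "r b < r c" "r c < r d" for a b c d
  proof -
    have side: "{x, y} \<subseteq> A \<or> {x, y} \<subseteq> B" if "{x, y} \<in> edges G" for x y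
      using that sep[of x y] sep[of y x] edge_verts[OF G that] AB(1) by (auto simp: insert_commute)
    have nA: "\<not> ({a, c} \<subseteq> A \<and> {b, d} \<subseteq> A)"
      using noncrossingD[OF r1(1), of a c b d] e rAle(1) by (auto simp: induced_def)
    have nB: "\<not> ({a, c} \<subseteq> B \<and> {b, d} \<subseteq> B)"
      using noncrossingD[OF r2(1), of a c b d] e rBge(1) by (auto simp: induced_def)
    show False
      using side[OF e(1)] side[OF e(2)] nA nB rAle(2)[of a] rAle(2)[of b] rAle(2)[of c] rAle(2)[of d]
        rBge(2)[of a] rBge(2)[of b] rBge(2)[of c] rBge(2)[of d] e(3-) by auto
  qed
  ultimately have "noncrossing r G" by (auto simp: noncrossing_def)
  thus thesis by (rule that)
qed

section \<open>Cycles: crossing chords and Hamiltonicity\<close>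

lemma closed_walk_rotate: "closed_walk G (us @ vs) \<Longrightarrow> closed_walk G (vs @ us)"
  by (cases "us = []"; cases "vs = []") (auto simp: closed_walk_def successively_append_iff)

text \<open>Cutting the cycle just before each of the four ends gives four arcs as branch sets:
  consecutive arcs touch along the cycle, opposite ones through the two chords.\<close>

lemma crossing_chords_K4:
  assumes cyc: "closed_walk G (ps @ a # qs @ b # ss @ c # ts @ d # us)"
    and vs: "set (ps @ a # qs @ b # ss @ c # ts @ d # us) \<subseteq> verts G"
    and "{a, c} \<in> edges G" "{b, d} \<in> edges G"
  shows "has_minor G (complete_graph 4)"
proof -
  define A where "A = a # qs"
  define B where "B = b # ss"
  define C where "C = c # ts"
  \<comment> \<open>The last arc runs past the end of the list back to its beginning.\<close>
  define D where "D = d # us @ ps"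
  have ne: "A \<noteq> []" "B \<noteq> []" "C \<noteq> []" "D \<noteq> []" by (auto simp: A_def B_def C_def D_def)
  have "closed_walk G (A @ B @ C @ D)"
    using closed_walk_rotate[of G ps "a # qs @ b # ss @ c # ts @ d # us"] cyc
    by (simp add: A_def B_def C_def D_def)
  hence w: "distinct (A @ B @ C @ D)"
    "successively (\<lambda>x y. {x, y} \<in> edges G) A" "successively (\<lambda>x y. {x, y} \<in> edges G) B"
    "successively (\<lambda>x y. {x, y} \<in> edges G) C" "successively (\<lambda>x y. {x, y} \<in> edges G) D"
    "{last A, hd B} \<in> edges G" "{last B, hd C} \<in> edges G" "{last C, hd D} \<in> edges G" "{last D, hd A} \<in> edges G"
    using ne by (auto simp: closed_walk_def successively_append_iff)
  show ?thesis
  proof (rule K4_minorI[of "set A" "set B" "set C" "set D"])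
    show "set A \<union> set B \<union> set C \<union> set D \<subseteq> verts G" using vs by (auto simp: A_def B_def C_def D_def)
    show "connected_in G (set A)" "connected_in G (set B)" "connected_in G (set C)" "connected_in G (set D)"
      using w ne by (auto intro!: connected_in_set)
    have t: "touching G (set xs) (set ys)" if "{x, y} \<in> edges G" "x \<in> set xs" "y \<in> set ys" for x y xs ys
      using that by (auto simp: touching_def)
    show "touching G (set A) (set B)" "touching G (set B) (set C)" "touching G (set C) (set D)"
      using w ne by (auto intro: t)
    have "touching G (set D) (set A)"
      using w ne by (auto intro: t)
    thus "touching G (set A) (set D)" by (simp add: touching_sym)
    show "touching G (set A) (set C)" "touching G (set B) (set D)"
      by (rule t[OF assms(3)] t[OF assms(4)]; simp add: A_def B_def C_def D_def)+
  qed (use w(1) in auto)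
qed

lemma split_at_four_indices:
  assumes "i < j" "j < k" "k < l" "l < length vs"
  obtains ps qs ss ts us where "vs = ps @ vs ! i # qs @ vs ! j # ss @ vs ! k # ts @ vs ! l # us"
proof -
  have "vs = take i vs @ vs ! i # drop (Suc i) vs" using assms by (intro id_take_nth_drop) auto
  moreover have "drop (Suc i) vs = take (j - Suc i) (drop (Suc i) vs) @ vs ! j # drop (Suc j) vs"
    using id_take_nth_drop[of "j - Suc i" "drop (Suc i) vs"] assms by simp
  moreover have "drop (Suc j) vs = take (k - Suc j) (drop (Suc j) vs) @ vs ! k # drop (Suc k) vs"
    using id_take_nth_drop[of "k - Suc j" "drop (Suc j) vs"] assms by simp
  moreover have "drop (Suc k) vs = take (l - Suc k) (drop (Suc k) vs) @ vs ! l # drop (Suc l) vs"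
    using id_take_nth_drop[of "l - Suc k" "drop (Suc k) vs"] assms by simp
  ultimately show thesis using that by metis
qed

lemma hamiltonian_noncrossing:
  assumes G: "simple_graph G" and cyc: "closed_walk G vs" "set vs = verts G"
    and K4: "\<not> has_minor G (complete_graph 4)"
  obtains r where "noncrossing r G"
proof -
  have dist: "distinct vs" using cyc by (simp add: closed_walk_def)
  have "\<forall>v\<in>verts G. \<exists>i. i < length vs \<and> vs ! i = v"
    unfolding cyc(2)[symmetric] by (simp add: in_set_conv_nth)
  from bchoice[OF this] obtain ix where ix: "\<And>v. v \<in> verts G \<Longrightarrow> ix v < length vs \<and> vs ! ix v = v"
    by blast
  define r where "r v = real (ix v)" for v
  have "inj_on r (verts G)"
    using ix by (intro inj_onI) (metis of_nat_eq_iff r_def)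
  moreover have False if e: "{a, c} \<in> edges G" "{b, d} \<in> edges G" "r a < r b" "r b < r c" "r c < r d" for a b c d
  proof -
    have V: "a \<in> verts G" "b \<in> verts G" "c \<in> verts G" "d \<in> verts G"
      using edge_verts[OF G e(1)] edge_verts[OF G e(2)] by auto
    have "ix a < ix b" "ix b < ix c" "ix c < ix d" "ix d < length vs"
      using e(3-) ix V by (auto simp: r_def)
    then obtain ps qs ss ts us where "vs = ps @ vs ! ix a # qs @ vs ! ix b # ss @ vs ! ix c # ts @ vs ! ix d # us"
      by (rule split_at_four_indices)
    hence eq: "vs = ps @ a # qs @ b # ss @ c # ts @ d # us"
      using ix V by simp
    show False
      using crossing_chords_K4[of G ps a qs b ss c ts d us, folded eq] cyc e(1,2) K4 by simp
  qed
  ultimately have "noncrossing r G" by (auto simp: noncrossing_def)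
  thus thesis by (rule that)
qed

text \<open>Let \<open>D\<close> be a component off the cycle and \<open>N\<close> its attachments
  on the cycle. The absence of small separations provides two attachments \<open>x\<close> and
  \<open>y\<close>, and maximality makes them nonconsecutive. Then \<open>D\<close> and the two arcs
  between them are three branch sets, each touching both \<open>x\<close> and
  \<open>y\<close>.\<close>

lemma longest_closed_walk_hamiltonian:
  assumes G: "simple_graph G" and K23: "\<not> has_minor G (complete_bipartite_graph 2 3)"
    and nosep: "\<And>A B v. A \<union> B = verts G \<Longrightarrow> A \<inter> B \<subseteq> {v} \<Longrightarrow>
      (\<And>x y. x \<in> A - B \<Longrightarrow> y \<in> B - A \<Longrightarrow> {x, y} \<notin> edges G) \<Longrightarrow> A = verts G \<or> B = verts G"
    and vs: "closed_walk G vs" "set vs \<subseteq> verts G"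
    and longest: "\<And>ws. closed_walk G ws \<Longrightarrow> set ws \<subseteq> verts G \<Longrightarrow> length ws \<le> length vs"
  shows "set vs = verts G"
proof (rule ccontr)
  assume "set vs \<noteq> verts G"
  then obtain v where v: "v \<in> verts G" "v \<notin> set vs" using vs by blast
  define R where "R = conn_rel G (verts G - set vs)"
  define D where "D = {w. (v, w) \<in> R\<^sup>*}"
  define N where "N = {x \<in> set vs. \<exists>d\<in>D. {x, d} \<in> edges G}"
  have vD: "v \<in> D" by (simp add: D_def)
  have D: "D \<subseteq> verts G - set vs"
  proof
    fix w assume "w \<in> D"
    hence "(v, w) \<in> R\<^sup>*" by (simp add: D_def)
    thus "w \<in> verts G - set vs" by induction (use v in \<open>auto simp: R_def conn_rel_def\<close>)
  qed
  have conn: "connected_in G D"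
  proof (rule connected_in_rootI[OF vD])
    fix w assume "w \<in> D"
    hence "(v, w) \<in> R\<^sup>*" by (simp add: D_def)
    thus "(v, w) \<in> (conn_rel G D)\<^sup>*"
    proof induction
      case (step y z)
      hence "y \<in> D" "z \<in> D" by (auto simp: D_def)
      with step show ?case by (auto simp: R_def conn_rel_def intro: rtrancl_into_rtrancl)
    qed simp
  qed
  have nbr: "y \<in> D \<union> N" if "x \<in> D" "{x, y} \<in> edges G" for x y
  proof (cases "y \<in> set vs")
    case True
    with that show ?thesis by (auto simp: N_def insert_commute)
  next
    case False
    hence "(x, y) \<in> R"
      using that D edge_verts[OF G that(2)] by (auto simp: R_def conn_rel_def)
    with that show ?thesis by (auto simp: D_def intro: rtrancl_into_rtrancl)
  qed
  \<comment> \<open>Otherwise \<open>D \<union> N\<close> and the complement of \<open>D\<close>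
    form a separation of order at most one.\<close>
  have "\<not> N \<subseteq> {x}" for x
  proof
    assume N: "N \<subseteq> {x}"
    have "D \<union> N = verts G \<or> verts G - D = verts G"
    proof (rule nosep[of _ _ x])
      show "D \<union> N \<union> (verts G - D) = verts G" using D vs by (auto simp: N_def)
      show "(D \<union> N) \<inter> (verts G - D) \<subseteq> {x}" using N by auto
      show "{a, b} \<notin> edges G" if "a \<in> D \<union> N - (verts G - D)" "b \<in> verts G - D - (D \<union> N)" for a b
        using that nbr[of a b] D vs by (auto simp: N_def)
    qed
    hence "set vs \<subseteq> N" using D vs vD by blast
    hence "card (set vs) \<le> 1"
      using N by (metis card_mono finite.intros card.empty card.insert empty_iff order_trans One_nat_def)
    thus False using vs by (auto simp: closed_walk_def distinct_card)
  qed
  then obtain x y where xy: "x \<in> N" "y \<in> N" "x \<noteq> y" by blast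
  then obtain d1 d2 where d: "d1 \<in> D" "{x, d1} \<in> edges G" "d2 \<in> D" "{y, d2} \<in> edges G"
    by (auto simp: N_def)
  obtain us ws where "vs = us @ x # ws"
    using xy by (auto simp: N_def in_set_conv_decomp)
  hence "closed_walk G (x # ws @ us)" "set (x # ws @ us) = set vs" "length (x # ws @ us) = length vs"
    using vs closed_walk_rotate[of G us "x # ws"] by auto
  moreover from this have "y \<in> set (ws @ us)" using xy by (auto simp: N_def)
  then obtain as bs where "ws @ us = as @ y # bs"
    using split_list[of y "ws @ us"] by blast
  ultimately have cyc: "closed_walk G (x # as @ y # bs)" and
    cs: "set (x # as @ y # bs) = set vs" and len: "length (x # as @ y # bs) = length vs"
    by simp_all
  obtain ps where ps: "path_between G d1 ps d2" "set ps \<subseteq> D"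
    using connected_in_path_between[OF conn d(1,3)] .
  have dps: "set ps \<inter> set vs = {}" "set ps \<subseteq> verts G" using ps D by auto
  \<comment> \<open>Otherwise the edge from \<open>x\<close> to \<open>y\<close> could be replaced
    by a detour through \<open>D\<close>, giving a longer closed walk. This includes walks of length
    2, where both arcs are empty.\<close>
  have "as \<noteq> []"
  proof
    assume [simp]: "as = []"
    have "closed_walk G (x # ps @ y # bs)"
      using cyc ps d dps cs
      by (auto simp: closed_walk_def path_between_def successively_append_iff successively_Cons insert_commute)
    moreover have "set (x # ps @ y # bs) \<subseteq> verts G" using dps cs vs by auto
    ultimately have "length (x # ps @ y # bs) \<le> length vs" by (rule longest)
    moreover have "0 < length ps" using ps by (simp add: path_between_def)
    ultimately show False using len by (cases ps) auto
  qed
  moreover have "bs \<noteq> []"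
  proof
    assume [simp]: "bs = []"
    have "closed_walk G (x # as @ y # rev ps)"
      using cyc path_between_rev[OF ps(1)] d dps cs
      by (auto simp: closed_walk_def path_between_def successively_append_iff successively_Cons insert_commute hd_append)
    moreover have "set (x # as @ y # rev ps) \<subseteq> verts G" using dps cs vs by auto
    ultimately have "length (x # as @ y # rev ps) \<le> length vs" by (rule longest)
    moreover have "0 < length ps" using ps by (simp add: path_between_def)
    ultimately show False using len by (cases ps) auto
  qed
  moreover have "has_minor G (complete_bipartite_graph 2 3)" if "as \<noteq> []" "bs \<noteq> []"
  proof (rule K23_minorI[of "{x}" "{y}" "set as" "set bs" D])
    show "{x} \<union> {y} \<union> set as \<union> set bs \<union> D \<subseteq> verts G" using cs vs D by auto
    have c: "distinct (x # as @ y # bs)" "successively (\<lambda>x y. {x, y} \<in> edges G) as"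
      "successively (\<lambda>x y. {x, y} \<in> edges G) bs" "{x, hd as} \<in> edges G" "{y, last as} \<in> edges G"
      "{y, hd bs} \<in> edges G" "{x, last bs} \<in> edges G"
      using cyc that by (auto simp: closed_walk_def successively_append_iff successively_Cons insert_commute)
    show "connected_in G (set as)" "connected_in G (set bs)"
      using c that by (auto intro: connected_in_set)
    show "touching G {x} (set as)" "touching G {x} (set bs)" "touching G {y} (set as)"
      "touching G {y} (set bs)" "touching G {x} D" "touching G {y} D"
      using c that d by (auto simp: touching_def)
    show "{x} \<inter> {y} = {}" "{x} \<inter> set as = {}" "{x} \<inter> set bs = {}" "{y} \<inter> set as = {}" "{y} \<inter> set bs = {}"
      "set as \<inter> set bs = {}"
      using c(1) by auto
    show "{x} \<inter> D = {}" "{y} \<inter> D = {}" "set as \<inter> D = {}" "set bs \<inter> D = {}"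
      using cs D by auto
  qed (use conn in \<open>auto simp: connected_in_singleton\<close>)
  ultimately show False using K23 by blast
qed

lemma noncrossing_if_no_minors:
  assumes "simple_graph G" "\<not> has_minor G (complete_graph 4)"
    "\<not> has_minor G (complete_bipartite_graph 2 3)"
  shows "\<exists>r. noncrossing r G"
  using assms
proof (induction "card (verts G)" arbitrary: G rule: less_induct)
  case less
  note G = less.prems(1)
  have fin: "finite (verts G)" using G by (simp add: simple_graph_def)
  show ?case
  proof (cases "card (verts G) \<le> 3")
    case True
    \<comment> \<open>A crossing involves four distinct vertices, so here any injection will
      do.\<close>
    obtain r :: "'a \<Rightarrow> nat" where r: "inj_on r (verts G)"
      using finite_imp_inj_to_nat_seg[OF fin] by blast
    have False if e: "{a, c} \<in> edges G" "{b, d} \<in> edges G" "r a < r b" "r b < r c" "r c < r d" for a b c d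
    proof -
      have "card {a, b, c, d} = 4" using e by (subst card_insert_disjoint; auto)+
      moreover have "{a, b, c, d} \<subseteq> verts G" using edge_verts[OF G e(1)] edge_verts[OF G e(2)] by auto
      hence "card {a, b, c, d} \<le> card (verts G)" by (rule card_mono[OF fin])
      ultimately show False using True by linarith
    qed
    hence "noncrossing (\<lambda>v. real (r v)) G"
      using r by (auto simp: noncrossing_def inj_on_def)
    thus ?thesis by blast
  next
    case large: False
    show ?thesis
    proof (cases "\<exists>A B v. A \<union> B = verts G \<and> A \<inter> B \<subseteq> {v} \<and>
        (\<forall>x\<in>A - B. \<forall>y\<in>B - A. {x, y} \<notin> edges G) \<and> A \<noteq> verts G \<and> B \<noteq> verts G")
      case True
      then obtain A B v where AB: "A \<union> B = verts G" "A \<inter> B \<subseteq> {v}"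
        "\<And>x y. x \<in> A - B \<Longrightarrow> y \<in> B - A \<Longrightarrow> {x, y} \<notin> edges G" "A \<noteq> verts G" "B \<noteq> verts G"
        by blast
      have ind: "\<exists>r. noncrossing r (induced G S)" if "S \<subset> verts G" for S
      proof (rule less.hyps)
        show "card (verts (induced G S)) < card (verts G)"
          using that fin by (simp add: induced_def psubset_card_mono)
        show "simple_graph (induced G S)" using that by (intro simple_graph_induced[OF G]) auto
      qed (use that less.prems(2,3) has_minor_induced in blast)+
      obtain rA where "noncrossing rA (induced G A)" using ind[of A] AB by blast
      moreover obtain rB where "noncrossing rB (induced G B)" using ind[of B] AB by blast
      ultimately show ?thesis using noncrossing_glue[OF G AB(1,2,3)] by blast
    next
      case False
      have nosep: "A = verts G \<or> B = verts G" if "A \<union> B = verts G" "A \<inter> B \<subseteq> {v}"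
        "\<And>x y. x \<in> A - B \<Longrightarrow> y \<in> B - A \<Longrightarrow> {x, y} \<notin> edges G" for A B v
      proof (rule ccontr)
        assume "\<not> (A = verts G \<or> B = verts G)"
        with that have "A \<union> B = verts G \<and> A \<inter> B \<subseteq> {v} \<and>
            (\<forall>x\<in>A - B. \<forall>y\<in>B - A. {x, y} \<notin> edges G) \<and> A \<noteq> verts G \<and> B \<noteq> verts G"
          by simp
        with False show False by (elim notE) (intro exI)
      qed
      have "verts G \<noteq> {}" using large by auto
      then obtain v where v: "v \<in> verts G" by blast
      \<comment> \<open>In an edgeless graph with several vertices, splitting off one vertex is a
        separation of order 0. The edge then provides a first closed walk, of length 2.\<close>
      have "edges G \<noteq> {}"
      proof
        assume E: "edges G = {}"
        have "{v} = verts G \<or> verts G - {v} = verts G"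
        proof (rule nosep)
          show "{v} \<union> (verts G - {v}) = verts G" using v by auto
          show "{v} \<inter> (verts G - {v}) \<subseteq> {v}" by simp
          show "{x, y} \<notin> edges G" for x y using E by simp
        qed
        hence "verts G = {v}" using v by auto
        thus False using large by simp
      qed
      then obtain a b where ab: "{a, b} \<in> edges G"
        using G by (metis card_2_iff ex_in_conv simple_graph_def)
      define L where "L = {length ws |ws. closed_walk G ws \<and> set ws \<subseteq> verts G}"
      have "closed_walk G [a, b]"
        using ab edge_neq[OF G ab] by (auto simp: closed_walk_def insert_commute)
      moreover have "set [a, b] \<subseteq> verts G" using edge_verts[OF G ab] by auto
      ultimately have "2 \<in> L" unfolding L_def by force
      have "length ws \<le> card (verts G)" if "closed_walk G ws" "set ws \<subseteq> verts G" for ws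
        using card_mono[OF fin that(2)] that(1) by (simp add: closed_walk_def distinct_card)
      hence "finite L" unfolding L_def by (intro finite_subset[OF _ finite_atMost[of "card (verts G)"]]) auto
      have "Max L \<in> L" using \<open>2 \<in> L\<close> \<open>finite L\<close> Max_in by blast
      then obtain vs where vs: "closed_walk G vs" "set vs \<subseteq> verts G" "length vs = Max L"
        by (auto simp: L_def)
      have longest: "length ws \<le> length vs" if "closed_walk G ws" "set ws \<subseteq> verts G" for ws
        unfolding vs(3) using that \<open>finite L\<close> by (intro Max_ge) (auto simp: L_def)
      have "set vs = verts G"
        by (rule longest_closed_walk_hamiltonian[OF G less.prems(3) nosep vs(1,2) longest])
      thus ?thesis
        using hamiltonian_noncrossing[OF G vs(1) _ less.prems(2)] by blast
    qed
  qed
qed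

section \<open>The affine map of an outerplanar graph\<close>

text \<open>Some edge of \<open>A\<close> leaves the open interval between \<open>b\<close> and
  \<open>d\<close>. As a chord it separates \<open>b\<close> from \<open>d\<close> in the cyclic
  order, so some edge of \<open>B\<close> has to cross it.\<close>

lemma noncrossing_connected:
  assumes G: "simple_graph G" and r: "noncrossing r G"
    and A: "connected_in G A" "A \<subseteq> verts G" and B: "connected_in G B" "B \<subseteq> verts G" and AB: "A \<inter> B = {}"
    and mem: "a \<in> A" "b \<in> B" "c \<in> A" "d \<in> B" and lt: "r a < r b" "r b < r c" "r c < r d"
  shows False
proof -
  have ne: "r x \<noteq> r y" if "x \<in> A" "y \<in> B" for x y
    using that inj_onD[of r "verts G" x y] r A(2) B(2) AB by (auto simp: noncrossing_def)
  obtain u v where uv: "u \<in> A" "v \<in> A" "{u, v} \<in> edges G" "r b < r u \<and> r u < r d" "\<not> (r b < r v \<and> r v < r d)"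
    using connected_in_crossing_edge[OF A(1) mem(3) mem(1), of "\<lambda>w. r b < r w \<and> r w < r d"] lt by auto
  have "r v < r b \<or> r d < r v"
    using uv(5) ne[OF uv(2) mem(2)] ne[OF uv(2) mem(4)] by auto
  thus False
  proof
    assume v: "r v < r b"
    obtain s t where st: "s \<in> B" "t \<in> B" "{s, t} \<in> edges G" "r v < r s \<and> r s < r u" "\<not> (r v < r t \<and> r t < r u)"
      using connected_in_crossing_edge[OF B(1) mem(2) mem(4), of "\<lambda>w. r v < r w \<and> r w < r u"] uv(4) v by auto
    have "r t < r v \<or> r u < r t"
      using st(5) ne[OF uv(1) st(2)] ne[OF uv(2) st(2)] by auto
    thus False
      using noncrossingD[OF r, of v u s t] noncrossingD[OF r, of t s v u] uv(3) st(3,4)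
      by (auto simp: insert_commute)
  next
    assume v: "r d < r v"
    obtain s t where st: "s \<in> B" "t \<in> B" "{s, t} \<in> edges G" "r u < r s \<and> r s < r v" "\<not> (r u < r t \<and> r t < r v)"
      using connected_in_crossing_edge[OF B(1) mem(4) mem(2), of "\<lambda>w. r u < r w \<and> r w < r v"] uv(4) v by auto
    have "r t < r u \<or> r v < r t"
      using st(5) ne[OF uv(1) st(2)] ne[OF uv(2) st(2)] by auto
    thus False
      using noncrossingD[OF r, of u v s t] noncrossingD[OF r, of t s u v] uv(3) st(3,4)
      by (auto simp: insert_commute)
  qed
qed

text \<open>Since disjoint connected sets never alternate, either the range of \<open>A\<close>
  avoids \<open>B\<close>, or \<open>B\<close> lies in a single gap of \<open>A\<close>. The
  interval is the range of the set that is avoided by the other.\<close>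

lemma noncrossing_interval:
  assumes G: "simple_graph G" and r: "noncrossing r G"
    and A: "connected_in G A" "A \<subseteq> verts G" and B: "connected_in G B" "B \<subseteq> verts G" and AB: "A \<inter> B = {}"
  shows "\<exists>s t. (\<forall>a\<in>A. s \<le> r a \<and> r a \<le> t) \<and> (\<forall>b\<in>B. \<not> (s \<le> r b \<and> r b \<le> t)) \<or>
               (\<forall>b\<in>B. s \<le> r b \<and> r b \<le> t) \<and> (\<forall>a\<in>A. \<not> (s \<le> r a \<and> r a \<le> t))"
proof -
  have ne: "r x \<noteq> r y" if "x \<in> A" "y \<in> B" for x y
    using that inj_onD[of r "verts G" x y] r A(2) B(2) AB by (auto simp: noncrossing_def)
  have minmax: "\<exists>x\<in>S. \<exists>y\<in>S. \<forall>z\<in>S. r x \<le> r z \<and> r z \<le> r y" if "connected_in G S" "S \<subseteq> verts G" for S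
  proof -
    have "finite S" "S \<noteq> {}"
      using that G by (auto simp: simple_graph_def connected_in_def finite_subset)
    hence "Min (r ` S) \<in> r ` S" "Max (r ` S) \<in> r ` S" by auto
    then obtain x y where "x \<in> S" "y \<in> S" "r x = Min (r ` S)" "r y = Max (r ` S)" by force
    thus ?thesis using \<open>finite S\<close> by (intro bexI[of _ x] bexI[of _ y]) auto
  qed
  obtain a0 a1 where a: "a0 \<in> A" "a1 \<in> A" "\<forall>z\<in>A. r a0 \<le> r z \<and> r z \<le> r a1"
    using minmax[OF A] by blast
  obtain b0 b1 where b: "b0 \<in> B" "b1 \<in> B" "\<forall>z\<in>B. r b0 \<le> r z \<and> r z \<le> r b1"
    using minmax[OF B] by blast
  note cAB = noncrossing_connected[OF G r A B AB]
  note cBA = noncrossing_connected[OF G r B A]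
  show ?thesis
  proof (cases "\<forall>b\<in>B. \<not> (r a0 \<le> r b \<and> r b \<le> r a1)")
    case True
    with a show ?thesis by blast
  next
    case False
    then obtain b where "b \<in> B" "r a0 \<le> r b" "r b \<le> r a1" by blast
    hence bin: "r a0 < r b" "r b < r a1"
      using ne[OF a(1), of b] ne[OF a(2), of b] by auto
    \<comment> \<open>With \<open>b0\<close> to the left of \<open>a0\<close>, the vertices
      \<open>b0\<close>, \<open>a0\<close>, \<open>b\<close>, \<open>a1\<close> would
      alternate.\<close>
    have b0: "r a0 < r b0"
    proof -
      have "\<not> r b0 < r a0"
        using cBA[OF _ b(1) a(1) \<open>b \<in> B\<close> a(2)] AB bin by (auto simp: Int_commute)
      thus ?thesis using ne[OF a(1) b(1)] by linarith
    qed
    have "\<not> (r b0 \<le> r x \<and> r x \<le> r b1)" if "x \<in> A" for x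
    proof
      assume "r b0 \<le> r x \<and> r x \<le> r b1"
      hence "r b0 < r x" "r x < r b1" using ne[OF that b(1)] ne[OF that b(2)] by auto
      thus False using cAB[OF a(1) b(1) that b(2)] b0 by simp
    qed
    with b show ?thesis by blast
  qed
qed

section \<open>Convex separation on the parabola\<close>

lemma parabola_separation:
  fixes A B :: "real set"
  assumes "\<And>a. a \<in> A \<Longrightarrow> s \<le> a \<and> a \<le> t" "\<And>b. b \<in> B \<Longrightarrow> \<not> (s \<le> b \<and> b \<le> t)" "s \<le> t"
  obtains C D where "convex C" "convex D" "C \<inter> D = {}"
    "\<And>a. a \<in> A \<Longrightarrow> Complex a (a\<^sup>2) \<in> C" "\<And>b. b \<in> B \<Longrightarrow> Complex b (b\<^sup>2) \<in> D"
proof -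
  txt \<open>The line through the points of the parabola over \<^term>\<open>s\<close> and \<^term>\<open>t\<close>.\<close>
  define n where "n = Complex (- (s + t)) 1"
  \<comment> \<open>The vertical height of the parabola over this line, a quadratic with roots
    \<open>s\<close> and \<open>t\<close>. The closed half-plane goes to \<open>A\<close>, which may
    contain the end points; for \<open>s = t\<close> the line is a tangent.\<close>
  have inner: "n \<bullet> Complex a (a\<^sup>2) + s * t = (a - s) * (a - t)" for a
    by (simp add: n_def inner_complex_def algebra_simps power2_eq_square)
  show thesis
  proof (rule that[of "{z. n \<bullet> z \<le> - (s * t)}" "{z. n \<bullet> z > - (s * t)}"])
    show "Complex a (a\<^sup>2) \<in> {z. n \<bullet> z \<le> - (s * t)}" if "a \<in> A" for a
    proof -
      have "(a - s) * (a - t) \<le> 0" using assms(1)[OF that] by (simp add: mult_nonneg_nonpos)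
      thus ?thesis using inner[of a] by simp
    qed
    show "Complex b (b\<^sup>2) \<in> {z. n \<bullet> z > - (s * t)}" if "b \<in> B" for b
    proof -
      have "b < s \<or> b > t" using assms(2)[OF that] by auto
      hence "(b - s) * (b - t) > 0"
        using assms(3) by (auto intro: mult_pos_pos mult_neg_neg)
      thus ?thesis using inner[of b] by simp
    qed
  qed (auto simp: convex_halfspace_le convex_halfspace_gt)
qed

lemma noncrossing_convex_separation:
  assumes G: "simple_graph G" and r: "noncrossing r G"
    and A: "connected_in G A" "A \<subseteq> verts G" and B: "connected_in G B" "B \<subseteq> verts G" and AB: "A \<inter> B = {}"
  obtains C D where "convex C" "convex D" "C \<inter> D = {}"
    "\<And>a. a \<in> A \<Longrightarrow> Complex (r a) ((r a)\<^sup>2) \<in> C" "\<And>b. b \<in> B \<Longrightarrow> Complex (r b) ((r b)\<^sup>2) \<in> D"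
proof -
  obtain a0 b0 where ne: "a0 \<in> A" "b0 \<in> B"
    using A(1) B(1) by (auto simp: connected_in_def)
  obtain s t where "(\<forall>a\<in>A. s \<le> r a \<and> r a \<le> t) \<and> (\<forall>b\<in>B. \<not> (s \<le> r b \<and> r b \<le> t)) \<or>
       (\<forall>b\<in>B. s \<le> r b \<and> r b \<le> t) \<and> (\<forall>a\<in>A. \<not> (s \<le> r a \<and> r a \<le> t))"
    using noncrossing_interval[OF assms] by blast
  thus thesis
  proof
    assume st: "(\<forall>a\<in>A. s \<le> r a \<and> r a \<le> t) \<and> (\<forall>b\<in>B. \<not> (s \<le> r b \<and> r b \<le> t))"
    hence "s \<le> r a0" "r a0 \<le> t" using ne by auto
    hence "s \<le> t" by linarith
    obtain C D where "convex C" "convex D" "C \<inter> D = {}"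
      "\<And>a. a \<in> r ` A \<Longrightarrow> Complex a (a\<^sup>2) \<in> C" "\<And>b. b \<in> r ` B \<Longrightarrow> Complex b (b\<^sup>2) \<in> D"
      by (rule parabola_separation[of "r ` A" s t "r ` B"]) (use st \<open>s \<le> t\<close> in auto)
    thus thesis by (intro that[of C D]) auto
  next
    assume st: "(\<forall>b\<in>B. s \<le> r b \<and> r b \<le> t) \<and> (\<forall>a\<in>A. \<not> (s \<le> r a \<and> r a \<le> t))"
    hence "s \<le> r b0" "r b0 \<le> t" using ne by auto
    hence "s \<le> t" by linarith
    obtain C D where "convex C" "convex D" "C \<inter> D = {}"
      "\<And>b. b \<in> r ` B \<Longrightarrow> Complex b (b\<^sup>2) \<in> C" "\<And>a. a \<in> r ` A \<Longrightarrow> Complex a (a\<^sup>2) \<in> D"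
      by (rule parabola_separation[of "r ` B" s t "r ` A"]) (use st \<open>s \<le> t\<close> in auto)
    thus thesis by (intro that[of D C]) auto
  qed
qed

definition affine_map :: "'a sgraph \<Rightarrow> ('a \<Rightarrow> complex) \<Rightarrow> ('a \<Rightarrow> real) \<Rightarrow> complex" where
  "affine_map G p x = (\<Sum>v\<in>verts G. x v *\<^sub>R p v)"

lemma continuous_on_affine_map: "continuous_on S (affine_map G p)"
proof -
  have "continuous_on S (\<lambda>x :: 'a \<Rightarrow> real. x v)" for v
    by (rule continuous_on_subset[OF continuous_on_product_coordinates]) simp
  thus ?thesis unfolding affine_map_def by (intro continuous_intros)
qed

lemma realization_support:
  assumes "x \<in> realization P" "simple_graph P"
  shows "x v \<noteq> 0 \<Longrightarrow> v \<in> verts P" "0 \<le> x v"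
proof -
  have s: "{v. x v \<noteq> 0} \<in> (\<lambda>v. {v}) ` verts P \<union> edges P"
    using assms(1) by (simp add: realization_def)
  show "0 \<le> x v" using assms(1) by (simp add: realization_def)
  have sub: "{v. x v \<noteq> 0} \<subseteq> verts P"
    using s
  proof
    assume "{v. x v \<noteq> 0} \<in> edges P"
    with assms(2) show ?thesis by (simp add: simple_graph_def)
  qed (elim imageE, simp)
  show "v \<in> verts P" if "x v \<noteq> 0" using sub that by blast
qed

text \<open>Points of a subgraph have no coordinates outside it, so their images are convex
  combinations of the images of its own vertices.\<close>

lemma affine_map_in_convex:
  assumes G: "simple_graph G" and P: "subgraph_of P G" and C: "convex C"
    and p: "\<And>v. v \<in> verts P \<Longrightarrow> p v \<in> C" and x: "x \<in> realization P"
  shows "affine_map G p x \<in> C"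
proof -
  have sP: "simple_graph P" and sub: "verts P \<subseteq> verts G" and fin: "finite (verts G)" "finite (verts P)"
    using P G by (auto simp: subgraph_of_def simple_graph_def)
  have "affine_map G p x = (\<Sum>v\<in>verts P. x v *\<^sub>R p v)"
    unfolding affine_map_def
    using realization_support(1)[OF x sP] sub fin by (intro sum.mono_neutral_right) auto
  also have "\<dots> \<in> C"
    using x realization_support(2)[OF x sP] p fin C
    by (intro convex_sum) (auto simp: realization_def)
  finally show ?thesis .
qed

lemma W_nonzero_cycle_in_convex:
  assumes f: "continuous_on (realization P) f" and C: "convex C" "f ` realization P \<subseteq> C"
  shows "W_nonzero_cycle f P \<subseteq> C"
proof
  fix z assume "z \<in> W_nonzero_cycle f P"
  then obtain \<gamma> where \<gamma>: "loop_around \<gamma> P" "z \<in> W_nonzero (f \<circ> \<gamma>)"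
    by (auto simp: W_nonzero_cycle_def)
  hence im: "path_image (f \<circ> \<gamma>) \<subseteq> C" and "path \<gamma>" and fin: "pathfinish (f \<circ> \<gamma>) = pathstart (f \<circ> \<gamma>)"
    using C(2) by (auto simp: loop_around_def path_image_compose simple_path_def pathfinish_compose pathstart_compose)
  have "path (f \<circ> \<gamma>)"
    using f \<gamma>(1) \<open>path \<gamma>\<close> by (intro path_continuous_image) (auto simp: loop_around_def)
  with winding_number_zero_outside[OF this C(1) fin _ im] im \<gamma>(2) show "z \<in> C"
    by (auto simp: W_nonzero_def)
qed

lemma path_or_cycle_connected:
  assumes P: "subgraph_of P G" and "path_graph P \<or> cycle_graph P"
  shows "connected_in G (verts P)"
proof -
  have E: "edges P \<subseteq> edges G" using P by (simp add: subgraph_of_def)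
  from assms(2) show ?thesis
  proof
    assume "path_graph P"
    then obtain vs where vs: "vs \<noteq> []" "verts P = set vs" "edges P = {{vs ! i, vs ! Suc i} |i. Suc i < length vs}"
      by (auto simp: path_graph_def)
    have "successively (\<lambda>x y. {x, y} \<in> edges G) vs"
      unfolding successively_conv_nth using vs(3) E by blast
    thus ?thesis unfolding vs(2) by (rule connected_in_set[OF vs(1)])
  next
    assume "cycle_graph P"
    then obtain vs where vs: "3 \<le> length vs" "verts P = set vs"
      "edges P = {{vs ! i, vs ! (Suc i mod length vs)} |i. i < length vs}"
      by (auto simp: cycle_graph_def)
    have "{vs ! i, vs ! Suc i} \<in> edges G" if "Suc i < length vs" for i
    proof -
      have "{vs ! i, vs ! (Suc i mod length vs)} \<in> edges P" using vs(3) that Suc_lessD by blast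
      thus ?thesis using that E by auto
    qed
    hence "successively (\<lambda>x y. {x, y} \<in> edges G) vs"
      unfolding successively_conv_nth by blast
    moreover have "vs \<noteq> []" using vs(1) by auto
    ultimately show ?thesis unfolding vs(2) by (intro connected_in_set)
  qed
qed

lemma noncrossing_imp_not_winding:
  assumes G: "simple_graph G" and r: "noncrossing r G"
  shows "\<not> winding_graph 2 G"
proof
  define p where "p v = Complex (r v) ((r v)\<^sup>2)" for v
  define f where "f = affine_map G p"
  have cont: "continuous_on S f" for S
    unfolding f_def by (rule continuous_on_affine_map)
  assume "winding_graph 2 G"
  hence "\<exists>P. (\<forall>i<2. subgraph_of (P i) G \<and> (path_graph (P i) \<or> cycle_graph (P i))) \<and>
     (\<forall>i<2. \<forall>j<2. i \<noteq> j \<longrightarrow> verts (P i) \<inter> verts (P j) = {}) \<and>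
     (\<Inter>i\<in>{i. i < 2 \<and> path_graph (P i)}. f ` realization (P i)) \<inter>
      (\<Inter>i\<in>{i. i < (2::nat) \<and> cycle_graph (P i)}. W_nonzero_cycle f (P i)) \<noteq> {}"
    using cont[of "realization G"] unfolding winding_graph_def by (elim allE[of _ f] impE)
  then obtain P where P: "\<forall>i<2. subgraph_of (P i) G \<and> (path_graph (P i) \<or> cycle_graph (P i))"
     "\<forall>i<2. \<forall>j<2. i \<noteq> j \<longrightarrow> verts (P i) \<inter> verts (P j) = {}"
     "(\<Inter>i\<in>{i. i < 2 \<and> path_graph (P i)}. f ` realization (P i)) \<inter>
      (\<Inter>i\<in>{i. i < (2::nat) \<and> cycle_graph (P i)}. W_nonzero_cycle f (P i)) \<noteq> {}"
    by (elim exE conjE)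
  obtain z where z: "z \<in> (\<Inter>i\<in>{i. i < 2 \<and> path_graph (P i)}. f ` realization (P i))"
    "z \<in> (\<Inter>i\<in>{i. i < (2::nat) \<and> cycle_graph (P i)}. W_nonzero_cycle f (P i))"
    using P(3) by (metis (no_types, lifting) Int_iff ex_in_conv)
  have sub: "subgraph_of (P i) G" "connected_in G (verts (P i))" "verts (P i) \<subseteq> verts G" if "i < 2" for i
    using P(1) that path_or_cycle_connected[of "P i" G] by (auto simp: subgraph_of_def)
  \<comment> \<open>Path or cycle, the set contributed by \<open>P i\<close> stays in every convex
    set containing the images of its vertices, so it suffices to separate these images.\<close>
  have in_convex: "z \<in> C" if i: "i < 2" and C: "convex C" "\<And>v. v \<in> verts (P i) \<Longrightarrow> p v \<in> C" for i C
  proof -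
    have im: "f ` realization (P i) \<subseteq> C"
      unfolding f_def using affine_map_in_convex[OF G sub(1)[OF i] C] by auto
    show ?thesis
    proof (cases "path_graph (P i)")
      case True
      thus ?thesis using z(1) i im by blast
    next
      case False
      hence "cycle_graph (P i)" using P(1) i by blast
      hence "z \<in> W_nonzero_cycle f (P i)" using z(2) i by blast
      thus ?thesis using W_nonzero_cycle_in_convex[OF cont C(1) im] by blast
    qed
  qed
  obtain C D where CD: "convex C" "convex D" "C \<inter> D = {}"
    "\<And>a. a \<in> verts (P 0) \<Longrightarrow> Complex (r a) ((r a)\<^sup>2) \<in> C" "\<And>b. b \<in> verts (P 1) \<Longrightarrow> Complex (r b) ((r b)\<^sup>2) \<in> D"
    by (rule noncrossing_convex_separation[OF G r, of "verts (P 0)" "verts (P 1)"]) (use sub P(2) in auto)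
  have "z \<in> C" by (rule in_convex[of 0]) (use CD in \<open>auto simp: p_def\<close>)
  moreover have "z \<in> D" by (rule in_convex[of 1]) (use CD in \<open>auto simp: p_def\<close>)
  ultimately show False using CD(3) by blast
qed

section \<open>Realizations of paths and cycles\<close>

definition vertex_point :: "'a \<Rightarrow> 'a \<Rightarrow> real" where
  "vertex_point u = (\<lambda>w. if w = u then 1 else 0)"

definition edge_path :: "'a \<Rightarrow> 'a \<Rightarrow> real \<Rightarrow> 'a \<Rightarrow> real" where
  "edge_path u v t = (\<lambda>w. if w = u then 1 - t else if w = v then t else 0)"

text \<open>Two vertices form a case of their own: appending the constant path at the last vertex
  would destroy the injectivity required of arcs and simple loops.\<close>

fun list_path :: "'a list \<Rightarrow> real \<Rightarrow> 'a \<Rightarrow> real" where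
  "list_path [] = undefined"
| "list_path [u] = (\<lambda>t. vertex_point u)"
| "list_path [u, v] = edge_path u v"
| "list_path (u # v # w # ws) = edge_path u v +++ list_path (v # w # ws)"

text \<open>The list may repeat its first vertex at the end, so one encoding serves paths and
  cycles.\<close>

definition list_graph :: "'a list \<Rightarrow> 'a sgraph" where
  "list_graph ws = \<lparr>verts = set ws, edges = {{ws ! i, ws ! Suc i} |i. Suc i < length ws}\<rparr>"

text \<open>Summing over the support makes the condition independent of a graph. Infinite supports
  are excluded, because such a sum is 0.\<close>

definition simplex_point :: "('a \<Rightarrow> real) \<Rightarrow> bool" where
  "simplex_point x \<longleftrightarrow> (\<forall>v. 0 \<le> x v) \<and> (\<Sum>v | x v \<noteq> 0. x v) = 1"

abbreviation supp :: "('a \<Rightarrow> real) \<Rightarrow> 'a set" where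
  "supp x \<equiv> {v. x v \<noteq> 0}"

text \<open>Membership now depends on the graph only through the support, so inclusions and
  intersections of realizations reduce to statements about vertices and edges.\<close>

lemma realization_eq:
  assumes "simple_graph P"
  shows "realization P = {x. simplex_point x \<and> supp x \<in> (\<lambda>v. {v}) ` verts P \<union> edges P}"
proof -
  have "(\<Sum>v\<in>verts P. x v) = (\<Sum>v | x v \<noteq> 0. x v)"
    if x: "supp x \<in> (\<lambda>v. {v}) ` verts P \<union> edges P" for x :: "'a \<Rightarrow> real"
  proof (rule sum.mono_neutral_right)
    show "finite (verts P)" using assms by (simp add: simple_graph_def)
    show "supp x \<subseteq> verts P"
      using x
    proof
      assume "supp x \<in> edges P"
      with assms show ?thesis by (simp add: simple_graph_def)
    qed (elim imageE, simp)
  qed simp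
  thus ?thesis
    unfolding realization_def simplex_point_def by (intro Collect_cong) (metis (no_types, lifting))
qed

lemma realization_mono:
  assumes "simple_graph P" "simple_graph Q" "verts P \<subseteq> verts Q" "edges P \<subseteq> edges Q"
  shows "realization P \<subseteq> realization Q"
  unfolding realization_eq[OF assms(1)] realization_eq[OF assms(2)] using assms(3,4) by auto

lemma simplex_point_singleton: "simplex_point x \<and> supp x = {u} \<longleftrightarrow> x = vertex_point u"
proof
  assume x: "simplex_point x \<and> supp x = {u}"
  hence "sum x {u} = 1" by (metis simplex_point_def)
  hence "x u = 1" by simp
  thus "x = vertex_point u" using x by (auto simp: vertex_point_def fun_eq_iff set_eq_iff)
next
  have "supp (vertex_point u) = {u}" by (auto simp: vertex_point_def)
  moreover assume "x = vertex_point u"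
  ultimately show "simplex_point x \<and> supp x = {u}" by (simp add: simplex_point_def vertex_point_def)
qed

lemma edge_path_simps [simp]: "edge_path u v 0 = vertex_point u" "u \<noteq> v \<Longrightarrow> edge_path u v 1 = vertex_point v"
  by (auto simp: edge_path_def vertex_point_def)

lemma edge_path_ends [simp]: "pathstart (edge_path u v) = vertex_point u" "u \<noteq> v \<Longrightarrow> pathfinish (edge_path u v) = vertex_point v"
  by (simp_all add: pathstart_def pathfinish_def)

lemma path_edge_path: "path (edge_path u v)"
  unfolding path_def edge_path_def
proof (intro continuous_on_coordinatewise_then_product)
  show "continuous_on {0..1} (\<lambda>t. if i = u then 1 - t else if i = v then t else (0::real))" for i
    by (cases "i = u"; cases "i = v") (simp_all add: continuous_on_diff)
qed

lemma arc_edge_path: "u \<noteq> v \<Longrightarrow> arc (edge_path u v)"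
  unfolding arc_def
proof (intro conjI path_edge_path inj_onI)
  fix s t assume "u \<noteq> v" "edge_path u v s = edge_path u v t"
  hence "edge_path u v s v = edge_path u v t v" by simp
  thus "s = t" using \<open>u \<noteq> v\<close> by (simp add: edge_path_def)
qed

lemma reversepath_edge_path: "u \<noteq> v \<Longrightarrow> reversepath (edge_path u v) = edge_path v u"
  by (auto simp: reversepath_def edge_path_def fun_eq_iff)

lemma path_image_edge_path:
  assumes uv: "u \<noteq> v"
  shows "path_image (edge_path u v) = {x. simplex_point x \<and> supp x \<in> {{u}, {v}, {u, v}}}"
proof (intro equalityI subsetI)
  fix x assume "x \<in> path_image (edge_path u v)"
  then obtain t where t: "0 \<le> t" "t \<le> 1" "x = edge_path u v t"
    by (auto simp: path_image_def)
  show "x \<in> {x. simplex_point x \<and> supp x \<in> {{u}, {v}, {u, v}}}"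
  proof (cases "t = 0 \<or> t = 1")
    case True
    thus ?thesis using t(3) uv simplex_point_singleton[of x u] simplex_point_singleton[of x v] by auto
  next
    case False
    have "supp x = {u, v}" using False uv t(3) by (auto simp: edge_path_def)
    moreover have "simplex_point x"
      unfolding simplex_point_def calculation using t uv by (auto simp: edge_path_def)
    ultimately show ?thesis by simp
  qed
next
  fix x assume x: "x \<in> {x. simplex_point x \<and> supp x \<in> {{u}, {v}, {u, v}}}"
  have ends: "vertex_point u \<in> path_image (edge_path u v)" "vertex_point v \<in> path_image (edge_path u v)"
    using uv pathstart_in_path_image[of "edge_path u v"] pathfinish_in_path_image[of "edge_path u v"] by auto
  show "x \<in> path_image (edge_path u v)"
  proof (cases "supp x = {u, v}")
    case True
    have "x u + x v = 1" "0 \<le> x u" "0 \<le> x v"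
      using x uv unfolding mem_Collect_eq simplex_point_def True by auto
    moreover have "x w = 0" if "w \<noteq> u" "w \<noteq> v" for w
      using that True by (auto simp: set_eq_iff)
    ultimately have "x = edge_path u v (x v)" "x v \<in> {0..1}"
      by (auto simp: edge_path_def fun_eq_iff)
    thus ?thesis unfolding path_image_def by (metis imageI)
  next
    case False
    hence "x = vertex_point u \<or> x = vertex_point v"
      using x simplex_point_singleton[of x u] simplex_point_singleton[of x v] by auto
    thus ?thesis using ends by auto
  qed
qed

lemma list_graph_simps [simp]:
  "verts (list_graph ws) = set ws" "edges (list_graph [u]) = {}"
  "edges (list_graph (u # v # ws)) = insert {u, v} (edges (list_graph (v # ws)))"
proof -
  show "edges (list_graph (u # v # ws)) = insert {u, v} (edges (list_graph (v # ws)))"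
  proof (intro equalityI subsetI)
    fix e assume "e \<in> edges (list_graph (u # v # ws))"
    then obtain i where "e = {(u # v # ws) ! i, (u # v # ws) ! Suc i}" "Suc i < length (u # v # ws)"
      by (auto simp: list_graph_def)
    thus "e \<in> insert {u, v} (edges (list_graph (v # ws)))"
      by (cases i) (auto simp: list_graph_def)
  next
    fix e assume "e \<in> insert {u, v} (edges (list_graph (v # ws)))"
    then consider "e = {u, v}" | i where "e = {(v # ws) ! i, (v # ws) ! Suc i}" "Suc i < length (v # ws)"
      by (auto simp: list_graph_def)
    thus "e \<in> edges (list_graph (u # v # ws))"
    proof cases
      case 1
      thus ?thesis by (auto simp: list_graph_def intro!: exI[of _ 0])
    next
      case (2 i)
      thus ?thesis by (auto simp: list_graph_def intro!: exI[of _ "Suc i"])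
    qed
  qed
qed (simp_all add: list_graph_def)

lemma edges_list_graph_subset: "e \<in> edges (list_graph ws) \<Longrightarrow> e \<subseteq> set ws"
  by (auto simp: list_graph_def)

lemma edges_list_graph_successively:
  "ws \<noteq> [] \<Longrightarrow> edges (list_graph ws) \<subseteq> E \<longleftrightarrow> successively (\<lambda>x y. {x, y} \<in> E) ws"
  by (induction ws rule: induct_list012) auto

lemma simple_graph_list_graph: "ws \<noteq> [] \<Longrightarrow> distinct_adj ws \<Longrightarrow> simple_graph (list_graph ws)"
  by (induction ws rule: induct_list012) (auto simp: simple_graph_def distinct_adj_def)

lemma distinct_imp_distinct_adj: "distinct ws \<Longrightarrow> distinct_adj ws"
  by (induction ws rule: induct_list012) auto

lemma list_path_ends:
  "ws \<noteq> [] \<Longrightarrow> distinct_adj ws \<Longrightarrow> pathstart (list_path ws) = vertex_point (hd ws) \<and> pathfinish (list_path ws) = vertex_point (last ws)"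
proof (induction ws rule: list_path.induct)
  case (4 u v w ws)
  thus ?case by (simp)
qed (auto simp: pathstart_def pathfinish_def)

lemma path_list_path: "ws \<noteq> [] \<Longrightarrow> distinct_adj ws \<Longrightarrow> path (list_path ws)"
proof (induction ws rule: list_path.induct)
  case (4 u v w ws)
  thus ?case using list_path_ends[of "v # w # ws"] path_edge_path[of u v]
    by (auto intro!: path_join_imp)
qed (auto simp: path_edge_path path_def[of "\<lambda>t. vertex_point _"])

lemma path_image_list_path:
  "ws \<noteq> [] \<Longrightarrow> distinct_adj ws \<Longrightarrow> path_image (list_path ws) = realization (list_graph ws)"
proof (induction ws rule: list_path.induct)
  case (2 u)
  have "realization (list_graph [u]) = {vertex_point u}"
    using simplex_point_singleton[of _ u] by (subst realization_eq) (auto simp: simple_graph_list_graph)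
  thus ?case by (auto simp: path_image_def)
next
  case (3 u v)
  hence "u \<noteq> v" by simp
  thus ?case using 3 by (subst realization_eq) (auto simp: simple_graph_list_graph path_image_edge_path)
next
  case (4 u v w ws)
  hence uv: "u \<noteq> v" and d: "distinct_adj (v # w # ws)" by auto
  have "path_image (list_path (u # v # w # ws)) = path_image (edge_path u v) \<union> realization (list_graph (v # w # ws))"
    using 4 uv d list_path_ends[of "v # w # ws"] by (simp add: path_image_join)
  also have "\<dots> = realization (list_graph (u # v # w # ws))"
    unfolding path_image_edge_path[OF uv] realization_eq[OF simple_graph_list_graph[OF _ d], simplified]
      realization_eq[OF simple_graph_list_graph[OF _ 4(3)], simplified]
    by auto
  finally show ?case .
qed simp

text \<open>No point of the remaining path has \<open>u\<close> in its support, so the first edge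
  meets it only in \<open>vertex_point v\<close>.\<close>

lemma arc_list_path: "2 \<le> length ws \<Longrightarrow> distinct ws \<Longrightarrow> arc (list_path ws)"
proof (induction ws rule: list_path.induct)
  case (4 u v w ws)
  hence uv: "u \<noteq> v" and d: "distinct (v # w # ws)" "distinct_adj (v # w # ws)"
    using distinct_imp_distinct_adj[of "v # w # ws"] by auto
  have "path_image (edge_path u v) \<inter> path_image (list_path (v # w # ws)) \<subseteq> {vertex_point v}"
  proof
    fix x assume x: "x \<in> path_image (edge_path u v) \<inter> path_image (list_path (v # w # ws))"
    hence "supp x \<in> (\<lambda>v. {v}) ` set (v # w # ws) \<union> edges (list_graph (v # w # ws))"
      using d by (simp add: path_image_list_path realization_eq simple_graph_list_graph)
    hence "supp x \<subseteq> set (v # w # ws)"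
    proof
      assume "supp x \<in> edges (list_graph (v # w # ws))"
      thus ?thesis by (rule edges_list_graph_subset)
    qed (elim imageE, simp)
    hence "u \<notin> supp x" using 4 by auto
    moreover have "simplex_point x \<and> supp x \<in> {{u}, {v}, {u, v}}"
      using x path_image_edge_path[OF uv] by blast
    ultimately have "simplex_point x \<and> supp x = {v}" by auto
    thus "x \<in> {vertex_point v}" by (simp only: simplex_point_singleton) simp
  qed
  thus ?case
    using 4 uv d list_path_ends[of "v # w # ws"] arc_edge_path[OF uv]
    by (auto intro!: arc_join)
next
  case (3 u v)
  thus ?case by (simp add: arc_edge_path)
qed auto

text \<open>The first vertex is repeated at the end.\<close>

definition closed_list :: "'a list \<Rightarrow> bool" where
  "closed_list ws \<longleftrightarrow> 4 \<le> length ws \<and> hd ws = last ws \<and> distinct (tl ws)"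

lemma closed_list_distinct_adj: "closed_list ws \<Longrightarrow> distinct_adj ws"
  by (cases ws rule: list_path.cases)
     (auto simp: closed_list_def distinct_adj_Cons dest: distinct_imp_distinct_adj)

lemma loop_around_list_path:
  assumes "closed_list ws"
  shows "loop_around (list_path ws) (list_graph ws)"
proof -
  have da: "distinct_adj ws" "ws \<noteq> []"
    using closed_list_distinct_adj[OF assms] assms by (auto simp: closed_list_def)
  obtain u v w x rs where ws: "ws = u # v # w # x # rs"
    using assms by (cases ws rule: list_path.cases; cases "drop 3 ws") (auto simp: closed_list_def)
  define ys where "ys = v # w # x # rs"
  have ys: "distinct ys" "last ys = u" "distinct_adj ys" "ys \<noteq> []" "2 \<le> length ys" and uv: "u \<noteq> v" and uw: "u \<noteq> w"
    using assms da unfolding closed_list_def ws ys_def by (auto split: if_splits)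
  \<comment> \<open>The first edge is not traversed again, because the cycle has at least three
    vertices; with two, the loop would return along the same edge.\<close>
  have nuv: "{u, v} \<notin> edges (list_graph ys)"
  proof
    assume "{u, v} \<in> edges (list_graph ys)"
    hence "{u, v} \<in> edges (list_graph (w # x # rs))"
      using uv uw by (auto simp: ys_def doubleton_eq_iff)
    hence "v \<in> set (w # x # rs)"
      using edges_list_graph_subset[of "{u, v}" "w # x # rs"] by auto
    thus False using ys(1) by (simp add: ys_def)
  qed
  have "path_image (edge_path u v) \<inter> path_image (list_path ys) \<subseteq> {vertex_point u, vertex_point v}"
  proof
    fix y assume y: "y \<in> path_image (edge_path u v) \<inter> path_image (list_path ys)"
    hence "simplex_point y" "supp y \<in> {{u}, {v}, {u, v}}"
      using path_image_edge_path[OF uv] by blast+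
    moreover have "supp y \<in> (\<lambda>v. {v}) ` set ys \<union> edges (list_graph ys)"
      using y ys by (simp add: path_image_list_path realization_eq simple_graph_list_graph)
    hence "supp y \<noteq> {u, v}" using nuv uv by (auto simp: singleton_insert_inj_eq)
    ultimately show "y \<in> {vertex_point u, vertex_point v}"
      using simplex_point_singleton[of y u] simplex_point_singleton[of y v] by auto
  qed
  moreover have "list_path ws = edge_path u v +++ list_path ys" by (simp add: ws ys_def)
  moreover have "hd ys = v" by (simp add: ys_def)
  ultimately have "simple_path (list_path ws)"
    using arc_edge_path[OF uv] arc_list_path[OF ys(5,1)] list_path_ends[OF ys(4,3)] ys(2) uv
    by (simp add: simple_path_join_loop)
  thus ?thesis
    using list_path_ends[OF da(2,1)] path_image_list_path[OF da(2,1)] assms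
    by (simp add: loop_around_def closed_list_def)
qed

lemma cycle_graph_list_graph:
  assumes "closed_list ws"
  shows "cycle_graph (list_graph ws)"
proof -
  define vs where "vs = butlast ws"
  define n where "n = length vs"
  have "ws \<noteq> []" using assms by (auto simp: closed_list_def)
  hence ws: "ws = vs @ [hd ws]"
    using assms by (metis append_butlast_last_id closed_list_def vs_def)
  have n: "3 \<le> n" using assms unfolding closed_list_def n_def vs_def length_butlast by linarith
  then obtain v us where vs: "vs = v # us" by (cases vs) (auto simp: n_def)
  have ws': "ws = v # us @ [v]" using ws vs by (metis append_Cons list.sel(1))
  hence dist: "distinct vs" using assms vs by (simp add: closed_list_def)
  have "{ws ! i, ws ! Suc i} = {vs ! i, vs ! (Suc i mod n)}" if "i < n" for i
  proof -
    have "ws ! i = vs ! i" using that vs ws' by (metis append_Cons n_def nth_append)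
    moreover have "ws ! Suc i = vs ! (Suc i mod n)"
    proof (cases "Suc i = n")
      case True
      hence "ws ! Suc i = v" using vs by (simp add: ws' n_def nth_append)
      thus ?thesis using True vs by simp
    next
      case False
      hence "Suc i < n" using that by simp
      thus ?thesis using vs ws' by (metis append_Cons mod_less n_def nth_append)
    qed
    ultimately show ?thesis by simp
  qed
  hence "(\<lambda>i. {ws ! i, ws ! Suc i}) ` {i. i < n} = (\<lambda>i. {vs ! i, vs ! (Suc i mod n)}) ` {i. i < n}"
    by (intro image_cong) auto
  moreover have "length ws = Suc n" using ws' vs by (simp add: n_def)
  ultimately have "edges (list_graph ws) = {{vs ! i, vs ! (Suc i mod n)} |i. i < n}"
    by (simp add: list_graph_def setcompr_eq_image)
  moreover have "set ws = set vs" using ws' vs by auto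
  ultimately show ?thesis
    unfolding cycle_graph_def using n dist by (intro exI[of _ vs]) (simp add: n_def)
qed

text \<open>An end of a path has at most one neighbour, a vertex of a cycle has two. The winding
  condition treats the two kinds separately, and a graph of both kinds would be constrained
  twice.\<close>

lemma path_graph_not_cycle_graph:
  assumes "path_graph P"
  shows "\<not> cycle_graph P"
proof
  assume "cycle_graph P"
  then obtain ws where ws: "3 \<le> length ws" "distinct ws" "verts P = set ws"
    "edges P = {{ws ! i, ws ! (Suc i mod length ws)} |i. i < length ws}"
    by (auto simp: cycle_graph_def)
  obtain vs where vs: "vs \<noteq> []" "distinct vs" "verts P = set vs"
    "edges P = {{vs ! i, vs ! Suc i} |i. Suc i < length vs}"
    using assms by (auto simp: path_graph_def)
  let ?n = "length ws"
  have uniq: "y = vs ! 1" if e: "{vs ! 0, y} \<in> edges P" for y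
  proof -
    obtain i where i: "{vs ! 0, y} = {vs ! i, vs ! Suc i}" "Suc i < length vs"
      using e vs(4) by auto
    have "i = 0"
    proof (rule ccontr)
      assume "i \<noteq> 0"
      hence "vs ! 0 \<noteq> vs ! i" "vs ! 0 \<noteq> vs ! Suc i"
        using i(2) vs(1,2) by (auto simp: nth_eq_iff_index_eq)
      thus False using i(1) by (auto simp: doubleton_eq_iff)
    qed
    moreover have "vs ! 0 \<noteq> vs ! 1" using i(2) vs(1,2) \<open>i = 0\<close> nth_eq_iff_index_eq[of vs 0 1] by simp
    ultimately show ?thesis using i(1) by (auto simp: doubleton_eq_iff)
  qed
  have "vs ! 0 \<in> set ws" using vs(1,3) ws(3) by (metis length_greater_0_conv nth_mem)
  then obtain k where k: "k < ?n" "ws ! k = vs ! 0" by (auto simp: in_set_conv_nth)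
  \<comment> \<open>The cyclic predecessor of \<open>k\<close>, distinct from its successor because
    the length is at least 3.\<close>
  define j where "j = (if k = 0 then ?n - 1 else k - 1)"
  have j: "j < ?n" "Suc j mod ?n = k" "Suc k mod ?n \<noteq> j" "Suc k mod ?n < ?n"
    using k(1) ws(1) by (auto simp: j_def mod_Suc)
  have "{ws ! k, ws ! (Suc k mod ?n)} \<in> edges P" "{ws ! j, ws ! (Suc j mod ?n)} \<in> edges P"
    unfolding ws(4) using k(1) j(1) by blast+
  hence "ws ! (Suc k mod ?n) = vs ! 1" "ws ! j = vs ! 1"
    using uniq[of "ws ! (Suc k mod ?n)"] uniq[of "ws ! j"] k(2) j(2) by (auto simp: insert_commute)
  hence "Suc k mod ?n = j"
    using ws(2) j by (metis nth_eq_iff_index_eq)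
  with j(3) show False by simp
qed

lemma path_graph_list_graph: "ws \<noteq> [] \<Longrightarrow> distinct ws \<Longrightarrow> path_graph (list_graph ws)"
  by (auto simp: path_graph_def list_graph_def)

section \<open>Winding numbers of subdivisions\<close>

text \<open>This captures the failure of the winding condition for \<^term>\<open>f\<close> only as far as it
  is used: two disjoint paths, or a single vertex and a cycle.\<close>

definition untangled :: "(('a \<Rightarrow> real) \<Rightarrow> complex) \<Rightarrow> 'a sgraph \<Rightarrow> bool" where
  "untangled f G \<longleftrightarrow> continuous_on (realization G) f \<and>
     (\<forall>u vs v x ws y. path_between G u vs v \<longrightarrow> path_between G x ws y \<longrightarrow> set vs \<union> set ws \<subseteq> verts G \<longrightarrow> set vs \<inter> set ws = {} \<longrightarrow>
        f ` realization (list_graph vs) \<inter> f ` realization (list_graph ws) = {}) \<and>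
     (\<forall>ws v. closed_list ws \<longrightarrow> successively (\<lambda>x y. {x, y} \<in> edges G) ws \<longrightarrow> set ws \<subseteq> verts G \<longrightarrow>
        v \<in> verts G - set ws \<longrightarrow>
        f (vertex_point v) \<notin> f ` realization (list_graph ws) \<and> winding_number (f \<circ> list_path ws) (f (vertex_point v)) = 0)"

section \<open>From a graph that is not 2-winding to an untangled map\<close>

lemma subgraph_list_graph:
  "ws \<noteq> [] \<Longrightarrow> distinct_adj ws \<Longrightarrow> successively (\<lambda>x y. {x, y} \<in> edges G) ws \<Longrightarrow> set ws \<subseteq> verts G \<Longrightarrow>
   subgraph_of (list_graph ws) G"
  using edges_list_graph_successively[of ws "edges G"] by (simp add: subgraph_of_def simple_graph_list_graph)

lemma realization_singleton: "realization (list_graph [u]) = {vertex_point u}"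
  using simplex_point_singleton[of _ u] by (subst realization_eq) (auto simp: simple_graph_list_graph)

text \<open>Packages a meeting pair as the indexed family of the winding condition; its
  contrapositive yields every disjointness statement about \<open>f\<close>.\<close>

lemma winding_2_if_pair:
  assumes "subgraph_of P G" "subgraph_of Q G" "path_graph P" "path_graph Q \<or> cycle_graph Q"
    "verts P \<inter> verts Q = {}" "z \<in> f ` realization P"
    "path_graph Q \<Longrightarrow> z \<in> f ` realization Q" "cycle_graph Q \<Longrightarrow> z \<in> W_nonzero_cycle f Q"
  shows "\<exists>P :: nat \<Rightarrow> 'a sgraph.
          (\<forall>i<2. subgraph_of (P i) G \<and> (path_graph (P i) \<or> cycle_graph (P i))) \<and>
          (\<forall>i<2. \<forall>j<2. i \<noteq> j \<longrightarrow> verts (P i) \<inter> verts (P j) = {}) \<and>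
          (\<Inter>i\<in>{i. i < 2 \<and> path_graph (P i)}. f ` realization (P i)) \<inter>
          (\<Inter>i\<in>{i. i < 2 \<and> cycle_graph (P i)}. W_nonzero_cycle f (P i)) \<noteq> {}"
proof -
  define R where "R i = (if i = 0 then P else Q)" for i :: nat
  have i2: "i = 0 \<or> i = 1" if "i < 2" for i :: nat using that by auto
  have R: "R 0 = P" "R 1 = Q" "R (Suc 0) = Q" by (simp_all add: R_def)
  have 1: "z \<in> f ` realization (R i)" if "i < 2" "path_graph (R i)" for i
    using i2[OF that(1)] that(2) assms(6,7) by (elim disjE) (simp_all add: R)
  have 2: "z \<in> W_nonzero_cycle f (R i)" if "i < 2" "cycle_graph (R i)" for i
    using i2[OF that(1)] that(2) assms(8) path_graph_not_cycle_graph[OF assms(3)]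
    by (elim disjE) (simp_all add: R)
  have 3: "z \<in> (\<Inter>i\<in>{i. i < 2 \<and> path_graph (R i)}. f ` realization (R i)) \<inter>
          (\<Inter>i\<in>{i. i < 2 \<and> cycle_graph (R i)}. W_nonzero_cycle f (R i))"
    using 1 2 by simp
  have 4: "subgraph_of (R i) G \<and> (path_graph (R i) \<or> cycle_graph (R i))" if "i < 2" for i
    using i2[OF that] assms(1-4) by (elim disjE) (simp_all add: R)
  have 5: "verts (R i) \<inter> verts (R j) = {}" if "i < 2" "j < 2" "i \<noteq> j" for i j
    using i2[OF that(1)] i2[OF that(2)] that(3) assms(5)
    by (elim disjE) (simp_all add: R Int_commute)
  show ?thesis
  proof (rule exI[of _ R], intro conjI)
    show "\<forall>i<2. subgraph_of (R i) G \<and> (path_graph (R i) \<or> cycle_graph (R i))" using 4 by simp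
    show "\<forall>i<2. \<forall>j<2. i \<noteq> j \<longrightarrow> verts (R i) \<inter> verts (R j) = {}" using 5 by simp
  qed (use 3 in \<open>rule ex_in_conv[THEN iffD1, OF exI]\<close>)
qed

lemma path_between_distinct_adj: "path_between G u ws v \<Longrightarrow> ws \<noteq> [] \<and> distinct_adj ws"
  by (simp add: path_between_def distinct_imp_distinct_adj)

lemma not_winding_imp_untangled:
  assumes "\<not> winding_graph 2 (G :: 'a sgraph)"
  obtains f where "untangled f G"
proof -
  obtain f :: "('a \<Rightarrow> real) \<Rightarrow> complex" where cont: "continuous_on (realization G) f"
    and f: "\<nexists>P :: nat \<Rightarrow> 'a sgraph.
          (\<forall>i<2. subgraph_of (P i) G \<and> (path_graph (P i) \<or> cycle_graph (P i))) \<and>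
          (\<forall>i<2. \<forall>j<2. i \<noteq> j \<longrightarrow> verts (P i) \<inter> verts (P j) = {}) \<and>
          (\<Inter>i\<in>{i. i < 2 \<and> path_graph (P i)}. f ` realization (P i)) \<inter>
          (\<Inter>i\<in>{i. i < 2 \<and> cycle_graph (P i)}. W_nonzero_cycle f (P i)) \<noteq> {}"
    using assms unfolding winding_graph_def not_all not_imp by (elim exE conjE)
  note no = winding_2_if_pair[of _ G _ _ f, THEN f[THEN notE]]
  show thesis
  proof (rule that[of f], unfold untangled_def, intro conjI allI impI cont)
    fix u vs v x ws y
    assume *: "path_between G u vs v" "path_between G x ws y" "set vs \<union> set ws \<subseteq> verts G" "set vs \<inter> set ws = {}"
    have s: "subgraph_of (list_graph vs) G" "subgraph_of (list_graph ws) G" "path_graph (list_graph vs)" "path_graph (list_graph ws)"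
      using * path_between_distinct_adj[OF *(1)] path_between_distinct_adj[OF *(2)]
      by (auto intro!: subgraph_list_graph path_graph_list_graph simp: path_between_def)
    show "f ` realization (list_graph vs) \<inter> f ` realization (list_graph ws) = {}"
    proof (rule ccontr)
      assume "\<not> ?thesis"
      then obtain z where z: "z \<in> f ` realization (list_graph vs)" "z \<in> f ` realization (list_graph ws)" by blast
      show False
        by (rule no[OF s(1,2,3) disjI1[OF s(4)] _ z(1)])
          (use z(2) *(4) path_graph_not_cycle_graph[OF s(4)] in auto)
    qed
  next
    fix ws v assume *: "closed_list ws" "successively (\<lambda>x y. {x, y} \<in> edges G) ws" "set ws \<subseteq> verts G" "v \<in> verts G - set ws"
    have ne: "ws \<noteq> []" "distinct_adj ws"
      using *(1) closed_list_distinct_adj[OF *(1)] by (auto simp: closed_list_def)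
    have s: "subgraph_of (list_graph [v]) G" "subgraph_of (list_graph ws) G" "path_graph (list_graph [v])" "cycle_graph (list_graph ws)"
      using * ne by (auto intro!: subgraph_list_graph path_graph_list_graph cycle_graph_list_graph)
    have loop: "loop_around (list_path ws) (list_graph ws)" by (rule loop_around_list_path[OF *(1)])
    have "f (vertex_point v) \<notin> W_nonzero (f \<circ> list_path ws)"
    proof
      assume "f (vertex_point v) \<in> W_nonzero (f \<circ> list_path ws)"
      hence W: "f (vertex_point v) \<in> W_nonzero_cycle f (list_graph ws)"
        using loop by (auto simp: W_nonzero_cycle_def)
      show False
        by (rule no[OF s(1,2,3) disjI2[OF s(4)], of "f (vertex_point v)"])
          (use W *(4) s(4) path_graph_not_cycle_graph[of "list_graph ws"] in \<open>auto simp: realization_singleton\<close>)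
    qed
    thus "f (vertex_point v) \<notin> f ` realization (list_graph ws)" "winding_number (f \<circ> list_path ws) (f (vertex_point v)) = 0"
      using path_image_list_path[OF ne] by (auto simp: W_nonzero_def path_image_compose)
  qed
qed

section \<open>Winding numbers as sums over edges\<close>

text \<open>The \<open>list_path\<close> of a reversed or concatenated list is in general only a
  reparametrization of the reversed or joined path. Comparing sums over edges makes reversal and
  concatenation literal identities.\<close>

fun edge_sum :: "('a \<Rightarrow> 'a \<Rightarrow> complex) \<Rightarrow> 'a list \<Rightarrow> complex" where
  "edge_sum g (u # v # ws) = g u v + edge_sum g (v # ws)"
| "edge_sum g _ = 0"

lemma edge_sum_append:
  "xs \<noteq> [] \<Longrightarrow> ys \<noteq> [] \<Longrightarrow> last xs = hd ys \<Longrightarrow> edge_sum g (xs @ tl ys) = edge_sum g xs + edge_sum g ys"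
proof (induction xs rule: induct_list012)
  case (2 x)
  thus ?case by (cases ys) auto
qed auto

lemma edge_sum_snoc: "edge_sum g (xs @ [u, v]) = edge_sum g (xs @ [u]) + g u v"
  using edge_sum_append[of "xs @ [u]" "[u, v]" g] by simp

lemma edge_sum_rev:
  assumes "successively (\<lambda>u v. g v u = - g u v) ws"
  shows "edge_sum g (rev ws) = - edge_sum g ws"
  using assms
proof (induction ws rule: induct_list012)
  case (3 u v ws)
  thus ?case using edge_sum_snoc[of g "rev ws" v u] by simp
qed auto

lemma winding_number_list_path:
  assumes "2 \<le> length ws" "distinct_adj ws" "continuous_on (realization (list_graph ws)) f"
    "z \<notin> f ` realization (list_graph ws)"
  shows "winding_number (f \<circ> list_path ws) z = edge_sum (\<lambda>u v. winding_number (f \<circ> edge_path u v) z) ws"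
  using assms
proof (induction ws rule: list_path.induct)
  case (4 u v w ws)
  let ?ys = "v # w # ws"
  have d: "u \<noteq> v" "distinct_adj ?ys" using 4 by auto
  have im: "path_image (edge_path u v) \<union> realization (list_graph ?ys) = realization (list_graph (u # ?ys))"
    using path_image_list_path[of "u # ?ys"] path_image_list_path[of ?ys] d list_path_ends[of ?ys]
    by (simp add: path_image_join)
  have c: "continuous_on (path_image (edge_path u v)) f" "continuous_on (realization (list_graph ?ys)) f"
    using 4(4) im by (metis continuous_on_subset Un_upper1 Un_upper2)+
  have z: "z \<notin> f ` path_image (edge_path u v)" "z \<notin> f ` realization (list_graph ?ys)"
    using 4(5) im by blast+
  have "winding_number (f \<circ> list_path (u # ?ys)) z = winding_number ((f \<circ> edge_path u v) +++ (f \<circ> list_path ?ys)) z"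
    by (simp add: path_compose_join)
  also have "\<dots> = winding_number (f \<circ> edge_path u v) z + winding_number (f \<circ> list_path ?ys) z"
  proof (rule winding_number_join)
    show "path (f \<circ> edge_path u v)" by (intro path_continuous_image path_edge_path c)
    show "path (f \<circ> list_path ?ys)"
      using d c by (intro path_continuous_image path_list_path) (simp_all add: path_image_list_path)
  qed (use z d list_path_ends[of ?ys] in \<open>simp_all add: path_image_compose path_image_list_path pathfinish_compose pathstart_compose\<close>)
  also have "winding_number (f \<circ> list_path ?ys) z = edge_sum (\<lambda>u v. winding_number (f \<circ> edge_path u v) z) ?ys"
    by (rule 4(1)) (use d c z in simp_all)
  finally show ?case by (simp only: edge_sum.simps)
qed auto

lemma set_append_tl: "set (xs @ tl ys) \<subseteq> set xs \<union> set ys"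
  by (cases ys) auto

lemma successively_verts:
  "simple_graph G \<Longrightarrow> successively (\<lambda>x y. {x, y} \<in> edges G) ws \<Longrightarrow> hd ws \<in> verts G \<Longrightarrow> set ws \<subseteq> verts G"
  by (induction ws rule: induct_list012) (auto dest: edge_verts)

lemma path_image_edge_path_subset:
  assumes "ws \<noteq> []" "distinct_adj ws" "{u, v} \<in> edges (list_graph ws)" "u \<noteq> v"
  shows "path_image (edge_path u v) \<subseteq> realization (list_graph ws)"
  unfolding path_image_edge_path[OF assms(4)] realization_eq[OF simple_graph_list_graph[OF assms(1,2)]]
  using assms(3) edges_list_graph_subset[OF assms(3)] by auto

lemma edge_sum_winding_rev:
  assumes ws: "ws \<noteq> []" "distinct_adj ws" and f: "continuous_on (realization (list_graph ws)) f"
    and z: "z \<notin> f ` realization (list_graph ws)"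
  shows "edge_sum (\<lambda>u v. winding_number (f \<circ> edge_path u v) z) (rev ws)
       = - edge_sum (\<lambda>u v. winding_number (f \<circ> edge_path u v) z) ws"
proof (rule edge_sum_rev, unfold successively_conv_nth, intro allI impI)
  fix i assume i: "Suc i < length ws"
  define u where "u = ws ! i"
  define v where "v = ws ! Suc i"
  have uv: "u \<noteq> v" using distinct_adj_nth[OF ws(2) i] by (simp add: u_def v_def)
  have "{u, v} \<in> edges (list_graph ws)" using i by (auto simp: list_graph_def u_def v_def)
  hence im: "path_image (edge_path u v) \<subseteq> realization (list_graph ws)"
    using path_image_edge_path_subset[OF ws _ uv] by simp
  have "path (f \<circ> edge_path u v)"
    by (intro path_continuous_image path_edge_path continuous_on_subset[OF f im])
  moreover have "z \<notin> path_image (f \<circ> edge_path u v)"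
    using z im by (auto simp: path_image_compose)
  ultimately have "winding_number (reversepath (f \<circ> edge_path u v)) z = - winding_number (f \<circ> edge_path u v) z"
    by (rule winding_number_reversepath)
  moreover have "reversepath (f \<circ> edge_path u v) = f \<circ> edge_path v u"
    using reversepath_edge_path[OF uv] by (metis path_compose_reversepath)
  ultimately show "winding_number (f \<circ> edge_path (ws ! Suc i) (ws ! i)) z = - winding_number (f \<circ> edge_path (ws ! i) (ws ! Suc i)) z"
    by (simp add: u_def v_def)
qed

lemma path_between_length: "path_between G u ws v \<Longrightarrow> u \<noteq> v \<Longrightarrow> 2 \<le> length ws"
  by (cases ws rule: list_path.cases) (auto simp: path_between_def)

lemma untangledD_continuous: "untangled f G \<Longrightarrow> continuous_on (realization G) f"
  by (simp add: untangled_def)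

lemma untangledD_disjoint:
  "untangled f G \<Longrightarrow> path_between G u vs v \<Longrightarrow> path_between G x ws y \<Longrightarrow> set vs \<subseteq> verts G \<Longrightarrow> set ws \<subseteq> verts G \<Longrightarrow>
   set vs \<inter> set ws = {} \<Longrightarrow> f ` realization (list_graph vs) \<inter> f ` realization (list_graph ws) = {}"
  unfolding untangled_def by (metis Un_least)

lemma untangledD_cycle:
  "untangled f G \<Longrightarrow> closed_list ws \<Longrightarrow> successively (\<lambda>x y. {x, y} \<in> edges G) ws \<Longrightarrow> set ws \<subseteq> verts G \<Longrightarrow>
   v \<in> verts G \<Longrightarrow> v \<notin> set ws \<Longrightarrow>
   f (vertex_point v) \<notin> f ` realization (list_graph ws) \<and> winding_number (f \<circ> list_path ws) (f (vertex_point v)) = 0"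
  by (simp add: untangled_def)

lemma untangledD_vertex:
  assumes "untangled f G" "path_between G x ws y" "set ws \<subseteq> verts G" "v \<in> verts G" "v \<notin> set ws"
  shows "f (vertex_point v) \<notin> f ` realization (list_graph ws)"
  using untangledD_disjoint[OF assms(1) _ assms(2), of v "[v]" v] assms(3-)
  by (simp add: path_between_def realization_singleton)

lemma continuous_on_list_graph:
  assumes "simple_graph G" "continuous_on (realization G) f" "ws \<noteq> []" "distinct_adj ws"
    "successively (\<lambda>x y. {x, y} \<in> edges G) ws" "set ws \<subseteq> verts G"
  shows "continuous_on (realization (list_graph ws)) f"
  using realization_mono[of "list_graph ws" G] subgraph_list_graph[OF assms(3-)] assms(1,2)
  by (auto simp: subgraph_of_def intro: continuous_on_subset)

text \<open>Two internally disjoint paths close up to a cycle, around which nothing winds. The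
  length condition rules out a single edge walked back and forth.\<close>

lemma untangled_cycle_sum:
  assumes G: "simple_graph G" and f: "untangled f G"
    and L: "path_between G a L1 b" "path_between G b L2 a" "a \<noteq> b" "set L1 \<inter> set L2 \<subseteq> {a, b}"
    and len: "3 \<le> length L1 \<or> 3 \<le> length L2"
    and V: "set L1 \<union> set L2 \<subseteq> verts G" "v \<in> verts G" "v \<notin> set L1 \<union> set L2"
  shows "edge_sum (\<lambda>x y. winding_number (f \<circ> edge_path x y) (f (vertex_point v))) L1
       + edge_sum (\<lambda>x y. winding_number (f \<circ> edge_path x y) (f (vertex_point v))) L2 = 0"
proof -
  obtain x xs where x: "L2 = b # x # xs"
    using L(2,3) by (cases L2 rule: list_path.cases) (auto simp: path_between_def)
  obtain y ys where y: "L1 = a # y # ys"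
    using L(1,3) by (cases L1 rule: list_path.cases) (auto simp: path_between_def)
  \<comment> \<open>\<open>tl\<close> drops the second copy of \<open>b\<close>, so the only
    repetition left is \<open>a\<close> at both ends.\<close>
  define ws where "ws = L1 @ tl L2"
  have "distinct L1" "distinct L2" "last L1 = b" "last L2 = a"
    using L by (auto simp: path_between_def)
  have d: "distinct (y # ys)" "distinct (x # xs)" "a \<notin> set (y # ys)" "b \<notin> set (x # xs)"
    using \<open>distinct L1\<close> \<open>distinct L2\<close> unfolding x y by (simp_all only: distinct.simps(2) simp_thms)
  have "set (y # ys) \<inter> set (x # xs) \<subseteq> set L1 \<inter> set L2"
    unfolding x y by (intro Int_mono) (simp_all add: subset_insertI subset_insertI2)
  hence "set (y # ys) \<inter> set (x # xs) = {}"
    using L(4) d(3,4) by blast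
  hence "distinct ((y # ys) @ (x # xs))"
    using d(1,2) by (simp only: distinct_append simp_thms)
  hence dist: "distinct (tl ws)"
    by (simp only: ws_def x y list.sel append_Cons)
  have closed: "closed_list ws"
    unfolding closed_list_def using dist len \<open>last L2 = a\<close> by (auto simp: ws_def x y)
  have succ: "successively (\<lambda>x y. {x, y} \<in> edges G) ws"
    using L(1,2) unfolding ws_def path_between_def by (auto simp: successively_append_iff x)
  have sub: "set ws \<subseteq> verts G" "v \<notin> set ws" using V by (auto simp: ws_def x)
  have ne: "ws \<noteq> []" "2 \<le> length ws" using closed by (auto simp: closed_list_def)
  note da = closed_list_distinct_adj[OF closed]
  note u = untangledD_cycle[OF f closed succ sub(1) V(2) sub(2)]
  have "edge_sum (\<lambda>x y. winding_number (f \<circ> edge_path x y) (f (vertex_point v))) ws = 0"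
    using winding_number_list_path[OF ne(2) da, of f "f (vertex_point v)"] u
      continuous_on_list_graph[OF G untangledD_continuous[OF f] ne(1) da succ sub(1)] by simp
  thus ?thesis
    using edge_sum_append[of L1 L2] L(1,2) by (simp add: ws_def path_between_def)
qed

section \<open>Winding relations of a subdivision\<close>

text \<open>This collects what the parity arguments use. Triangles and 4-cycles suffice, as these
  are the cycles missing a vertex in K4 and in K_{2,3} respectively.\<close>

definition winding_system :: "'b sgraph \<Rightarrow> ('b \<Rightarrow> 'b \<Rightarrow> 'b \<Rightarrow> complex) \<Rightarrow> ('b \<Rightarrow> complex) \<Rightarrow> bool" where
  "winding_system H W P \<longleftrightarrow> inj_on P (verts H) \<and>
    (\<forall>v u w. {u, w} \<in> edges H \<longrightarrow> v \<in> verts H - {u, w} \<longrightarrow>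
       P w - P v = exp (2 * of_real pi * \<i> * W v u w) * (P u - P v) \<and> W v w u = - W v u w) \<and>
    (\<forall>u w u' w'. {u, w} \<in> edges H \<longrightarrow> {u', w'} \<in> edges H \<longrightarrow> {u, w} \<inter> {u', w'} = {} \<longrightarrow>
       W u' u w + W w u' w' = W u u' w' + W w' u w) \<and>
    (\<forall>v u w x. {u, w} \<in> edges H \<longrightarrow> {w, x} \<in> edges H \<longrightarrow> {x, u} \<in> edges H \<longrightarrow> v \<in> verts H - {u, w, x} \<longrightarrow>
       W v u w + W v w x + W v x u = 0) \<and>
    (\<forall>v u w x y. {u, w} \<in> edges H \<longrightarrow> {w, x} \<in> edges H \<longrightarrow> {x, y} \<in> edges H \<longrightarrow> {y, u} \<in> edges H \<longrightarrow>
       distinct [u, w, x, y] \<longrightarrow> v \<in> verts H - {u, w, x, y} \<longrightarrow>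
       W v u w + W v w x + W v x y + W v y u = 0)"

text \<open>A branch vertex is a path by itself, so untangledness keeps its image \<open>P v\<close>
  off every subdivided edge not ending at \<open>v\<close>. Winding numbers around
  \<open>P v\<close> along those edges are therefore defined, and disjoint edges and cycles supply
  the relations.\<close>

lemma topological_minor_winding:
  assumes G: "simple_graph G" and H: "simple_graph H" and f: "untangled f G" and tm: "topological_minor G H c p"
  obtains W P where "winding_system H W P"
proof -
  have inj: "inj_on c (verts H)" and cV: "c ` verts H \<subseteq> verts G"
    and dp: "\<And>v w. {v, w} \<in> edges H \<Longrightarrow> path_between G (c v) (p v w) (c w)"
    and pr: "\<And>v w. {v, w} \<in> edges H \<Longrightarrow> p w v = rev (p v w)"
    and av: "\<And>v w u. {v, w} \<in> edges H \<Longrightarrow> u \<in> verts H \<Longrightarrow> c u \<in> set (p v w) \<Longrightarrow> u \<in> {v, w}"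
    and adj: "\<And>v w u. {v, w} \<in> edges H \<Longrightarrow> {v, u} \<in> edges H \<Longrightarrow> w \<noteq> u \<Longrightarrow> set (p v w) \<inter> set (p v u) = {c v}"
    and dj: "\<And>v w t u. {v, w} \<in> edges H \<Longrightarrow> {t, u} \<in> edges H \<Longrightarrow> {v, w} \<inter> {t, u} = {} \<Longrightarrow>
        set (p v w) \<inter> set (p t u) = {}"
    using tm unfolding topological_minor_def by simp_all
  define P where "P v = f (vertex_point (c v))" for v
  define g where "g v = (\<lambda>x y. winding_number (f \<circ> edge_path x y) (P v))" for v
  define W where "W v u w = edge_sum (g v) (p u w)" for v u w
  note cont = untangledD_continuous[OF f]
  have Hv: "v \<in> verts H" "w \<in> verts H" "v \<noteq> w" "c v \<noteq> c w" "c v \<in> verts G" "c w \<in> verts G" "{w, v} \<in> edges H"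
    if "{v, w} \<in> edges H" for v w
    using edge_verts[OF H that] edge_neq[OF H that] inj cV that
    by (auto simp: inj_on_def insert_commute)
  have sV: "set (p v w) \<subseteq> verts G" if e: "{v, w} \<in> edges H" for v w
    using successively_verts[OF G, of "p v w"] dp[OF e] Hv(5)[OF e] by (auto simp: path_between_def)
  have pd: "p v w \<noteq> []" "distinct_adj (p v w)" "2 \<le> length (p v w)"
      "continuous_on (realization (list_graph (p v w))) f" if e: "{v, w} \<in> edges H" for v w
  proof -
    show 1: "p v w \<noteq> []" "distinct_adj (p v w)" using path_between_distinct_adj[OF dp[OF e]] by auto
    show "2 \<le> length (p v w)" by (rule path_between_length[OF dp[OF e] Hv(4)[OF e]])
    show "continuous_on (realization (list_graph (p v w))) f"
      using dp[OF e] by (intro continuous_on_list_graph[OF G cont 1 _ sV[OF e]]) (simp add: path_between_def)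
  qed
  have path: "path (f \<circ> list_path (p v w))" "pathstart (f \<circ> list_path (p v w)) = P v" "pathfinish (f \<circ> list_path (p v w)) = P w"
      "path_image (f \<circ> list_path (p v w)) = f ` realization (list_graph (p v w))" if e: "{v, w} \<in> edges H" for v w
  proof -
    note im = path_image_list_path[OF pd(1,2)[OF e]]
    show "path (f \<circ> list_path (p v w))"
      by (intro path_continuous_image path_list_path pd(1,2)[OF e]) (simp add: im pd(4)[OF e])
    show "path_image (f \<circ> list_path (p v w)) = f ` realization (list_graph (p v w))"
      by (simp add: path_image_compose im)
    show "pathstart (f \<circ> list_path (p v w)) = P v" "pathfinish (f \<circ> list_path (p v w)) = P w"
      using list_path_ends[OF pd(1,2)[OF e]] dp[OF e]
      by (simp_all add: pathstart_compose pathfinish_compose P_def path_between_def)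
  qed
  have off: "c v \<in> verts G" "c v \<notin> set (p u w)" "P v \<notin> f ` realization (list_graph (p u w))"
    if e: "{u, w} \<in> edges H" and v: "v \<in> verts H - {u, w}" for v u w
  proof -
    show 1: "c v \<in> verts G" using cV v by auto
    show 2: "c v \<notin> set (p u w)" using av[OF e, of v] v by auto
    show "P v \<notin> f ` realization (list_graph (p u w))"
      unfolding P_def by (rule untangledD_vertex[OF f dp[OF e] sV[OF e] 1 2])
  qed
  \<comment> \<open>Both descriptions of \<open>W\<close> are needed: the sum over edges for
    reversal and cycles, the winding number of the whole path for the exponential and the
    square.\<close>
  have Weq: "W v u w = winding_number (f \<circ> list_path (p u w)) (P v)"
    if e: "{u, w} \<in> edges H" and v: "v \<in> verts H - {u, w}" for v u w
    unfolding W_def g_def using winding_number_list_path[OF pd(3,2,4)[OF e] off(3)[OF e v]] by simp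
  have sprev: "set (p w v) = set (p v w)" if "{v, w} \<in> edges H" for v w
    using pr[OF that] by simp
  show thesis
  proof (rule that[of W P], unfold winding_system_def, intro conjI allI impI)
    show "inj_on P (verts H)"
    proof (rule inj_onI, rule ccontr)
      fix v w assume vw: "v \<in> verts H" "w \<in> verts H" "P v = P w" "v \<noteq> w"
      have "c v \<in> verts G" "c w \<in> verts G" "c v \<notin> set [c w]"
        using vw inj cV by (auto simp: inj_on_def)
      hence "f (vertex_point (c v)) \<notin> f ` realization (list_graph [c w])"
        by (intro untangledD_vertex[OF f, of "c w" _ "c w"]) (auto simp: path_between_def)
      thus False using vw(3) by (simp add: realization_singleton P_def)
    qed
  next
    fix v u w assume e: "{u, w} \<in> edges H" and v: "v \<in> verts H - {u, w}"
    show "P w - P v = exp (2 * of_real pi * \<i> * W v u w) * (P u - P v)"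
      using winding_number_exp_2pi[OF path(1)[OF e], of "P v"] off(3)[OF e v] path[OF e] Weq[OF e v] by simp
    show "W v w u = - W v u w"
      unfolding W_def g_def pr[OF e] by (rule edge_sum_winding_rev[OF pd(1,2,4)[OF e] off(3)[OF e v]])
  next
    fix u w u' w' assume e: "{u, w} \<in> edges H" and e': "{u', w'} \<in> edges H" and d: "{u, w} \<inter> {u', w'} = {}"
    have v: "u' \<in> verts H - {u, w}" "w' \<in> verts H - {u, w}" "u \<in> verts H - {u', w'}" "w \<in> verts H - {u', w'}"
      using Hv(1,2)[OF e] Hv(1,2)[OF e'] d by auto
    have "path_image (f \<circ> list_path (p u w)) \<inter> path_image (f \<circ> list_path (p u' w')) = {}"
      unfolding path(4)[OF e] path(4)[OF e']
      by (rule untangledD_disjoint[OF f dp[OF e] dp[OF e'] sV[OF e] sV[OF e'] dj[OF e e' d]])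
    from winding_number_square[OF path(1)[OF e] path(1)[OF e'] this]
    show "W u' u w + W w u' w' = W u u' w' + W w' u w"
      unfolding path(2,3)[OF e] path(2,3)[OF e'] Weq[OF e v(1)] Weq[OF e v(2)] Weq[OF e' v(3)] Weq[OF e' v(4)] .
  next
    fix v u w x assume e: "{u, w} \<in> edges H" "{w, x} \<in> edges H" "{x, u} \<in> edges H" and v: "v \<in> verts H - {u, w, x}"
    have ne: "u \<noteq> w" "w \<noteq> x" "x \<noteq> u" using e Hv(3) by auto
    have i: "set (p w x) \<inter> set (p x u) = {c x}" "set (p u w) \<inter> set (p w x) = {c w}" "set (p u w) \<inter> set (p x u) = {c u}"
      using adj[OF Hv(7)[OF e(2)] e(3)] adj[OF Hv(7)[OF e(1)] e(2)] adj[OF e(1) Hv(7)[OF e(3)]] ne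
        sprev[OF e(1)] sprev[OF e(2)] sprev[OF e(3)] by auto
    \<comment> \<open>The triangle is cut at \<open>u\<close> and \<open>w\<close>, with the two
      paths through \<open>x\<close> joined into one.\<close>
    have "path_between G (c w) (p w x @ tl (p x u)) (c u)"
      by (rule path_between_glue[OF dp[OF e(2)] dp[OF e(3)]]) (simp add: i)
    moreover have st: "set (p w x @ tl (p x u)) \<subseteq> set (p w x) \<union> set (p x u)"
      by (intro set_append_tl)+
    ultimately have "edge_sum (g v) (p u w) + edge_sum (g v) (p w x @ tl (p x u)) = 0"
      unfolding g_def P_def
    proof (intro untangled_cycle_sum[OF G f dp[OF e(1)]])
      show "set (p u w) \<inter> set (p w x @ tl (p x u)) \<subseteq> {c u, c w}" using st i by blast
      show "set (p u w) \<union> set (p w x @ tl (p x u)) \<subseteq> verts G" using st sV e by blast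
      show "c v \<notin> set (p u w) \<union> set (p w x @ tl (p x u))" using st off(2)[OF e(1), of v] off(2)[OF e(2), of v] off(2)[OF e(3), of v] v by blast
      show "3 \<le> length (p u w) \<or> 3 \<le> length (p w x @ tl (p x u))" using pd(3)[OF e(2)] pd(3)[OF e(3)] unfolding length_append length_tl by linarith
    qed (use Hv(4)[OF e(1)] off(1)[OF e(1)] v in auto)
    moreover have "edge_sum (g v) (p w x @ tl (p x u)) = W v w x + W v x u"
      unfolding W_def using dp[OF e(2)] dp[OF e(3)] by (intro edge_sum_append) (auto simp: path_between_def)
    ultimately show "W v u w + W v w x + W v x u = 0"
      by (simp add: W_def add.assoc)
  next
    fix v u w x y assume e: "{u, w} \<in> edges H" "{w, x} \<in> edges H" "{x, y} \<in> edges H" "{y, u} \<in> edges H"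
      and ne: "distinct [u, w, x, y]" and v: "v \<in> verts H - {u, w, x, y}"
    have i: "set (p u w) \<inter> set (p w x) = {c w}" "set (p x y) \<inter> set (p y u) = {c y}"
      "set (p u w) \<inter> set (p x y) = {}" "set (p u w) \<inter> set (p y u) = {c u}"
      "set (p w x) \<inter> set (p x y) = {c x}" "set (p w x) \<inter> set (p y u) = {}"
      using adj[OF Hv(7)[OF e(1)] e(2)] adj[OF Hv(7)[OF e(3)] e(4)] dj[OF e(1) e(3)] adj[OF e(1) Hv(7)[OF e(4)]]
        adj[OF Hv(7)[OF e(2)] e(3)] dj[OF e(2) e(4)] ne
        sprev[OF e(1)] sprev[OF e(2)] sprev[OF e(3)] sprev[OF e(4)] by auto
    \<comment> \<open>The 4-cycle is cut at the opposite vertices \<open>u\<close> and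
      \<open>x\<close> into two halves of two paths each.\<close>
    have 1: "path_between G (c u) (p u w @ tl (p w x)) (c x)"
      by (rule path_between_glue[OF dp[OF e(1)] dp[OF e(2)]]) (simp add: i)
    have 2: "path_between G (c x) (p x y @ tl (p y u)) (c u)"
      by (rule path_between_glue[OF dp[OF e(3)] dp[OF e(4)]]) (simp add: i)
    have st: "set (p u w @ tl (p w x)) \<subseteq> set (p u w) \<union> set (p w x)" "set (p x y @ tl (p y u)) \<subseteq> set (p x y) \<union> set (p y u)"
      by (intro set_append_tl)+
    have "c u \<noteq> c x" using inj ne Hv(1)[OF e(1)] Hv(1)[OF e(3)] by (auto simp: inj_on_def)
    have "edge_sum (g v) (p u w @ tl (p w x)) + edge_sum (g v) (p x y @ tl (p y u)) = 0"
      unfolding g_def P_def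
    proof (rule untangled_cycle_sum[OF G f 1 2 \<open>c u \<noteq> c x\<close>])
      have "(set (p u w) \<union> set (p w x)) \<inter> (set (p x y) \<union> set (p y u)) \<subseteq> {c u, c x}"
        by (simp add: Int_Un_distrib Int_Un_distrib2 i)
      with Int_mono[OF st] show "set (p u w @ tl (p w x)) \<inter> set (p x y @ tl (p y u)) \<subseteq> {c u, c x}"
        by (rule order_trans)
      show "set (p u w @ tl (p w x)) \<union> set (p x y @ tl (p y u)) \<subseteq> verts G"
        by (rule order_trans[OF Un_mono[OF st]]) (simp add: sV e)
      have "c v \<notin> set (p u w)" "c v \<notin> set (p w x)" "c v \<notin> set (p x y)" "c v \<notin> set (p y u)"
        using off(2)[OF e(1), of v] off(2)[OF e(2), of v] off(2)[OF e(3), of v] off(2)[OF e(4), of v] v by simp_all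
      hence "c v \<notin> (set (p u w) \<union> set (p w x)) \<union> (set (p x y) \<union> set (p y u))" by simp
      thus "c v \<notin> set (p u w @ tl (p w x)) \<union> set (p x y @ tl (p y u))"
        by (rule contra_subsetD[OF Un_mono[OF st]])
      show "3 \<le> length (p u w @ tl (p w x)) \<or> 3 \<le> length (p x y @ tl (p y u))"
        using pd(3)[OF e(1)] pd(3)[OF e(2)] unfolding length_append length_tl by linarith
    qed (use off(1)[OF e(1)] v in auto)
    moreover have "edge_sum (g v) (p u w @ tl (p w x)) = W v u w + W v w x"
      unfolding W_def using dp[OF e(1)] dp[OF e(2)] by (intro edge_sum_append) (auto simp: path_between_def)
    moreover have "edge_sum (g v) (p x y @ tl (p y u)) = W v x y + W v y u"
      unfolding W_def using dp[OF e(3)] dp[OF e(4)] by (intro edge_sum_append) (auto simp: path_between_def)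
    ultimately show "W v u w + W v w x + W v x y + W v y u = 0"
      by (simp add: add.assoc)
  qed
qed

section \<open>The two minors force winding\<close>

lemma simple_complete_graph: "simple_graph (complete_graph n)"
  by (auto simp: simple_graph_def complete_graph_def)

lemma simple_complete_bipartite_graph: "simple_graph (complete_bipartite_graph m n)"
  by (auto simp: simple_graph_def complete_bipartite_graph_def)

lemma K4_minor_winding:
  assumes G: "simple_graph G" and minor: "has_minor G (complete_graph 4)"
  shows "winding_graph 2 G"
proof (rule ccontr)
  let ?K = "complete_graph 4"
  assume "\<not> winding_graph 2 G"
  then obtain f where f: "untangled f G" by (rule not_winding_imp_untangled)
  have V: "verts ?K = {0, 1, 2, 3}" by (auto simp: complete_graph_def)
  have E: "{v, w} \<in> edges ?K" if "v \<in> verts ?K" "w \<in> verts ?K" "v \<noteq> w" for v w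
    using that by (simp add: complete_graph_def card_2_iff) blast
  have deg: "card {w. {v, w} \<in> edges ?K} \<le> 3" if "v \<in> verts ?K" for v
  proof -
    have "{w. {v, w} \<in> edges ?K} \<subseteq> {0, 1, 2, 3} - {v}"
      using edge_neq[OF simple_complete_graph, of v _ 4] edge_verts[OF simple_complete_graph, of v _ 4] V by blast
    moreover have "card ({0, 1, 2, 3} - {v}) = 3" using that V by (simp add: card_Diff_singleton)
    ultimately show ?thesis by (metis card_mono finite.emptyI finite.insertI finite_Diff)
  qed
  obtain c p where tm: "topological_minor G ?K c p"
    by (rule subcubic_minor_imp_topological_minor[OF G simple_complete_graph minor deg])
  obtain W P where "winding_system ?K W P"
    by (rule topological_minor_winding[OF G simple_complete_graph f tm])
  hence inj: "inj_on P (verts ?K)"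
    and 1: "\<And>v u w. {u, w} \<in> edges ?K \<Longrightarrow> v \<in> verts ?K - {u, w} \<Longrightarrow>
       P w - P v = exp (2 * of_real pi * \<i> * W v u w) * (P u - P v) \<and> W v w u = - W v u w"
    and 2: "\<And>u w u' w'. {u, w} \<in> edges ?K \<Longrightarrow> {u', w'} \<in> edges ?K \<Longrightarrow> {u, w} \<inter> {u', w'} = {} \<Longrightarrow>
       W u' u w + W w u' w' = W u u' w' + W w' u w"
    and 3: "\<And>v u w x. {u, w} \<in> edges ?K \<Longrightarrow> {w, x} \<in> edges ?K \<Longrightarrow> {x, u} \<in> edges ?K \<Longrightarrow> v \<in> verts ?K - {u, w, x} \<Longrightarrow>
       W v u w + W v w x + W v x u = 0"
    unfolding winding_system_def by simp_all
  show False
  proof (rule K4_winding_parity[of 0 1 2 3 P W])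
    show "inj_on P {0, 1, 2, 3}" using inj V by simp
  next
    fix v u w :: nat assume *: "distinct [v, u, w]" "set [v, u, w] \<subseteq> {0, 1, 2, 3}"
    have "{u, w} \<in> edges ?K" by (rule E) (use * V in auto)
    note 1[OF this, of v]
    thus "P w - P v = exp (2 * of_real pi * \<i> * W v u w) * (P u - P v)" "W v w u = - W v u w"
      using * V by auto
  next
    fix u w u' w' :: nat assume *: "distinct [u, w, u', w']" "set [u, w, u', w'] \<subseteq> {0, 1, 2, 3}"
    show "W u' u w + W w u' w' = W u u' w' + W w' u w"
      by (rule 2; (rule E)?) (use * V in auto)
  next
    fix v u w x :: nat assume *: "distinct [v, u, w, x]" "set [v, u, w, x] \<subseteq> {0, 1, 2, 3}"
    show "W v u w + W v w x + W v x u = 0"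
      by (rule 3; (rule E)?) (use * V in auto)
  qed simp
qed

lemma K23_minor_winding:
  assumes G: "simple_graph G" and minor: "has_minor G (complete_bipartite_graph 2 3)"
  shows "winding_graph 2 G"
proof (rule ccontr)
  let ?K = "complete_bipartite_graph 2 3"
  let ?L = "{Inl 0, Inl 1} :: (nat + nat) set" and ?R = "{Inr 0, Inr 1, Inr 2} :: (nat + nat) set"
  assume "\<not> winding_graph 2 G"
  then obtain f where f: "untangled f G" by (rule not_winding_imp_untangled)
  have V: "verts ?K = ?L \<union> ?R" by (force simp: complete_bipartite_graph_def)
  have E: "{v, w} \<in> edges ?K \<and> {w, v} \<in> edges ?K" if vw: "v \<in> ?L" "w \<in> ?R" for v w
  proof -
    obtain i j :: nat where ij: "v = Inl i" "w = Inr j" "i < 2" "j < 3"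
      using vw by force
    hence "{v, w} \<in> edges ?K"
      unfolding complete_bipartite_graph_def sgraph.simps ij(1,2) using ij(3,4) by blast
    thus ?thesis by (simp add: insert_commute)
  qed
  have nE: "v \<in> ?L \<and> w \<in> ?R \<or> v \<in> ?R \<and> w \<in> ?L" if "{v, w} \<in> edges ?K" for v w
  proof -
    obtain i j :: nat where ij: "{v, w} = {Inl i, Inr j}" "i < 2" "j < 3"
      using \<open>{v, w} \<in> edges ?K\<close> by (auto simp: complete_bipartite_graph_def)
    have "Inl i \<in> ?L" "Inr j \<in> ?R" using ij(2,3) by auto
    thus ?thesis using ij(1) by (auto simp: doubleton_eq_iff)
  qed
  have deg: "card {w. {v, w} \<in> edges ?K} \<le> 3" if "v \<in> verts ?K" for v
  proof (cases "v \<in> ?L")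
    case True
    have "{w. {v, w} \<in> edges ?K} \<subseteq> ?R" using nE True by blast
    hence "card {w. {v, w} \<in> edges ?K} \<le> card ?R" by (intro card_mono) auto
    thus ?thesis by simp
  next
    case False
    have "{w. {v, w} \<in> edges ?K} \<subseteq> ?L" using nE False by blast
    hence "card {w. {v, w} \<in> edges ?K} \<le> card ?L" by (intro card_mono) auto
    thus ?thesis by simp
  qed
  obtain c p where tm: "topological_minor G ?K c p"
    by (rule subcubic_minor_imp_topological_minor[OF G simple_complete_bipartite_graph minor deg])
  obtain W P where "winding_system ?K W P"
    by (rule topological_minor_winding[OF G simple_complete_bipartite_graph f tm])
  hence inj: "inj_on P (verts ?K)"
    and 1: "\<And>v u w. {u, w} \<in> edges ?K \<Longrightarrow> v \<in> verts ?K - {u, w} \<Longrightarrow>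
       P w - P v = exp (2 * of_real pi * \<i> * W v u w) * (P u - P v) \<and> W v w u = - W v u w"
    and 2: "\<And>u w u' w'. {u, w} \<in> edges ?K \<Longrightarrow> {u', w'} \<in> edges ?K \<Longrightarrow> {u, w} \<inter> {u', w'} = {} \<Longrightarrow>
       W u' u w + W w u' w' = W u u' w' + W w' u w"
    and 3: "\<And>v u w x y. {u, w} \<in> edges ?K \<Longrightarrow> {w, x} \<in> edges ?K \<Longrightarrow> {x, y} \<in> edges ?K \<Longrightarrow> {y, u} \<in> edges ?K \<Longrightarrow>
       distinct [u, w, x, y] \<Longrightarrow> v \<in> verts ?K - {u, w, x, y} \<Longrightarrow>
       W v u w + W v w x + W v x y + W v y u = 0"
    unfolding winding_system_def by simp_all
  show False
  proof (rule K23_winding_parity[of "Inl 0" "Inl 1" "Inr 0" "Inr 1" "Inr 2" P W])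
    show "inj_on P {Inl 0, Inl 1, Inr 0, Inr 1, Inr 2}" using inj V by (simp add: insert_commute)
  next
    fix v u w assume *: "u \<in> ?L" "v \<in> ?R" "w \<in> ?R" "v \<noteq> w"
    have "v \<in> verts ?K - {u, w}" using * V by auto
    from 1[OF conjunct1[OF E[OF *(1,3)]] this]
    show "P w - P v = exp (2 * of_real pi * \<i> * W v u w) * (P u - P v)" "W v w u = - W v u w"
      by simp_all
  next
    fix w w' assume *: "w \<in> ?R" "w' \<in> ?R" "w \<noteq> w'"
    have L: "Inl 0 \<in> ?L" "Inl 1 \<in> ?L" by simp_all
    have "{Inl 0, w} \<inter> {w', Inl 1} = {}" using * by auto
    from 2[OF conjunct1[OF E[OF L(1) *(1)]] conjunct2[OF E[OF L(2) *(2)]] this]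
    show "W w' (Inl 0) w + W w w' (Inl 1) = W (Inl 0) w' (Inl 1) + W (Inl 1) (Inl 0) w" .
  next
    fix v w w' assume *: "distinct [v, w, w']" "set [v, w, w'] \<subseteq> ?R"
    hence R: "v \<in> ?R" "w \<in> ?R" "w' \<in> ?R" by simp_all
    have L: "Inl 0 \<in> ?L" "Inl 1 \<in> ?L" by simp_all
    show "W v (Inl 0) w + W v w (Inl 1) + W v (Inl 1) w' + W v w' (Inl 0) = 0"
    proof (rule 3)
      show "distinct [Inl 0, w, Inl 1, w']" using * by auto
      show "v \<in> verts ?K - {Inl 0, w, Inl 1, w'}" using * V by auto
    qed (use E[OF L(1) R(2)] E[OF L(2) R(2)] E[OF L(2) R(3)] E[OF L(1) R(3)] in simp_all)
  qed simp
qed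

theorem theorem3p2p5:
  fixes G :: "'a sgraph"
  assumes "simple_graph G"
  shows "winding_graph 2 G \<longleftrightarrow>
    has_minor G (complete_graph 4) \<or> has_minor G (complete_bipartite_graph 2 3)"
  using K4_minor_winding[OF assms] K23_minor_winding[OF assms] noncrossing_if_no_minors[OF assms]
    noncrossing_imp_not_winding[OF assms] by blast

end
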